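(* Let $\beta>0$ and $T\in(0,1)$. The sequence $\{n^{-1}\log\Delta^{G,\beta}_n(T)\}_n$ satisfies an LDP in $\mathbb R$ in the scale $2\beta^{-1}n^{-2}$ with a good rate function $I^G_T$ given as follows. (1) If $\xi\in[-T,0)$, the equation $\mathcal J(1+\theta)-\mathcal J(1-T+\theta)-T\log(1+\theta)=\xi$ has a unique solution $\theta\in[-(1-T),\infty)$, and $I^G_T(\xi)=\theta\xi+T\mathcal J(1+\theta)+F(1)-F(1-T)-F(1+\theta)+F(1-T+\theta)$. (2) If $\xi<-T$, $I^G_T(\xi)=I^G_T(-T)-(1-T)(\xi+T)$. (3) If $\xi\ge0$, $I^G_T(\xi)=+\infty$.
   Context: $\beta'=\beta/2$; $\rho^{G,\beta}_{1,n}:=1$, $\rho^{G,\beta}_{k,n}$ ($2\le k\le n$) independent with $\rho^{G,\beta}_{k,n}\sim\mathrm{Beta}(\beta'(n-k+1),\beta'(k-1))$; $\log\Delta^{G,\beta}_n(T)=\sum_{k=1}^{\lfloor nT\rfloor}\log\rho^{G,\beta}_{k,n}$. $\mathcal J(u)=u\log u-u+1$ ($u>0$), $\mathcal J(0)=1$, $+\infty$ for $u<0$; $F(t)=\int_0^t\mathcal J(u)du=\frac{t^2}2\log t-\frac{3t^2}4+t$ ($t\ge0$, $F(0)=0$). LDP in the scale $2\beta^{-1}n^{-2}$: upper bound $\limsup\frac{2}{\beta n^2}\log P(\cdot\in C)\le-\inf_CI$ for closed $C$, lower bound $\liminf\frac2{\beta n^2}\log P(\cdot\in O)\ge-\inf_OI$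 for open $O$, $I$ with compact level sets. *)

theory Defs
  imports "HOL-Probability.Probability"
begin

definition beta_density :: "real \<Rightarrow> real \<Rightarrow> real \<Rightarrow> real" where
  "beta_density a b x =
     (if 0 < x \<and> x < 1 then x powr (a - 1) * (1 - x) powr (b - 1) / Beta a b else 0)"

text \<open>J(u) = u log u - u + 1 for u > 0, J(0) = 1 (J = +infinity for u < 0 is never used).\<close>
definition Jfun :: "real \<Rightarrow> real" where
  "Jfun u = (if u = 0 then 1 else u * ln u - u + 1)"

definition Ffun :: "real \<Rightarrow> real" where
  "Ffun t = (if t = 0 then 0 else t^2 / 2 * ln t - 3 * t^2 / 4 + t)"

definition theta_eq :: "real \<Rightarrow> real \<Rightarrow> real \<Rightarrow> bool" where
  "theta_eq T \<xi> \<theta> \<longleftrightarrow>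
     Jfun (1 + \<theta>) - Jfun (1 - T + \<theta>) - T * ln (1 + \<theta>) = \<xi>"

definition IG_core :: "real \<Rightarrow> real \<Rightarrow> real" where
  "IG_core T \<xi> =
     (let \<theta> = (THE \<theta>. \<theta> \<ge> -(1 - T) \<and> theta_eq T \<xi> \<theta>)
      in \<theta> * \<xi> + T * Jfun (1 + \<theta>) + Ffun 1 - Ffun (1 - T) - Ffun (1 + \<theta>) + Ffun (1 - T + \<theta>))"

definition IG :: "real \<Rightarrow> real \<Rightarrow> ereal" where
  "IG T \<xi> =
     (if 0 \<le> \<xi> then \<infinity>
      else if -T \<le> \<xi> then ereal (IG_core T \<xi>)
      else ereal (IG_core T (-T) - (1 - T) * (\<xi> + T)))"

definition ln_prob :: "real \<Rightarrow> ereal" where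
  "ln_prob p = (if p = 0 then -\<infinity> else ereal (ln p))"

end

theory Submission
  imports Defs "HOL-Real_Asymp.Real_Asymp"
begin

text \<open>The Laplace transform of \<open>\<Sum>k. ln (\<rho> n k)\<close> is a product of quotients of Beta functions. Since
  \<open>ln \<Gamma> x = x ln x - x + O(ln x)\<close>, the cumulants of \<open>X n\<close>, scaled by \<open>\<beta> n\<^sup>2 / 2\<close>, are Riemann sums that
  converge for \<open>s > -(1 - T)\<close> to an explicit convex function \<open>\<Lambda>\<close> with
  \<open>\<Lambda>' \<theta> = J(1 + \<theta>) - J(1 - T + \<theta>) - T ln (1 + \<theta>)\<close>, and the rate function is its Legendre transform. The
  upper bound is Chernoff's inequality on half-lines. As \<open>\<Lambda>\<close> is not steep at \<open>-(1 - T)\<close>, where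
  \<open>\<Lambda>' = -T\<close>, tilting yields the lower bound only at points of \<open>(-T, 0)\<close>. A point \<open>\<xi> \<le> -T\<close> is
  reached by keeping all factors but the last near a value \<open>y\<close> slightly above \<open>-T\<close> and forcing the last one to be of
  order \<open>exp (- n (y - \<xi>))\<close>; this costs \<open>(1 - T) (y - \<xi>)\<close> and produces the linear part of the rate function.\<close>

subsection \<open>The limiting cumulant generating function and the rate function\<close>

lemma Jfun_eq: "Jfun u = u * ln u - u + 1"
  by (simp add: Jfun_def)

lemma Ffun_eq: "Ffun t = t\<^sup>2 / 2 * ln t - 3 * t\<^sup>2 / 4 + t"
  by (simp add: Ffun_def)

text \<open>The function \<Lambda> of the proof idea: the integral of
  \<open>Jfun (1 - u + s) - Jfun (1 - u) - Jfun (1 + s)\<close> over u from 0 to T, evaluated with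
  the primitive \<open>Ffun\<close>. It is differentiated in s for the Legendre transform and in T
  for the Riemann sums.\<close>

definition cumulant :: "real \<Rightarrow> real \<Rightarrow> real" where
  "cumulant T s = Ffun (1 + s) - Ffun (1 - T + s) - Ffun 1 + Ffun (1 - T) - T * Jfun (1 + s)"

definition dcumulant :: "real \<Rightarrow> real \<Rightarrow> real" where
  "dcumulant T s = Jfun (1 + s) - Jfun (1 - T + s) - T * ln (1 + s)"

lemma theta_eq_iff: "theta_eq T \<xi> \<theta> \<longleftrightarrow> dcumulant T \<theta> = \<xi>"
  by (simp add: theta_eq_def dcumulant_def)

lemma cumulant_0 [simp]: "cumulant T 0 = 0"
  by (simp add: cumulant_def Jfun_def)

text \<open>The argument \<open>1 - T + s\<close> reaches 0 at the left end of the domain, where the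
  rate function changes to its linear branch, so continuity at 0 matters. There
  \<open>u * ln u\<close> evaluates to 0, which is its limit from the right.\<close>

lemma continuous_on_mult_ln: "continuous_on {0..} (\<lambda>u::real. u * ln u)"
proof -
  have "continuous (at u within {0..}) (\<lambda>u::real. u * ln u)" if "u \<ge> 0" for u
  proof (cases "u = 0")
    case True
    have "((\<lambda>u::real. u * ln u) \<longlongrightarrow> 0) (at_right 0)"
      by real_asymp
    then show ?thesis
      using True by (simp add: continuous_within at_within_Ici_at_right)
  next
    case False
    then show ?thesis using that
      by (intro continuous_intros) auto
  qed
  then show ?thesis
    by (simp add: continuous_on_eq_continuous_within)
qed

lemma continuous_on_Jfun: "continuous_on {0..} Jfun"
  unfolding Jfun_eq by (intro continuous_intros continuous_on_mult_ln)

lemma continuous_on_Ffun: "continuous_on {0..} Ffun"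
proof -
  have "continuous_on {0..} (\<lambda>t. t / 2 * (t * ln t) - 3 * t\<^sup>2 / 4 + t :: real)"
    by (intro continuous_intros continuous_on_mult_ln) auto
  moreover have "Ffun = (\<lambda>t. t / 2 * (t * ln t) - 3 * t\<^sup>2 / 4 + t)"
    by (simp add: fun_eq_iff Ffun_eq power2_eq_square)
  ultimately show ?thesis by (simp only:)
qed

lemma DERIV_Jfun: "u > 0 \<Longrightarrow> (Jfun has_real_derivative ln u) (at u)"
  unfolding Jfun_eq by (auto intro!: derivative_eq_intros)

lemma DERIV_Ffun: "u > 0 \<Longrightarrow> (Ffun has_real_derivative Jfun u) (at u)"
  unfolding Jfun_eq Ffun_eq
  by (auto intro!: derivative_eq_intros simp: field_simps power2_eq_square)

section \<open>Convexity of the limiting cumulant function and Legendre duality\<close>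

context
  fixes T :: real
  assumes T: "0 < T" "T < 1"
begin

lemma continuous_on_cumulant: "continuous_on {-(1-T)..} (cumulant T)"
  unfolding cumulant_def using T
  by (intro continuous_intros continuous_on_compose2[OF continuous_on_Ffun]
        continuous_on_compose2[OF continuous_on_Jfun]) auto

lemma continuous_on_dcumulant: "continuous_on {-(1-T)..} (dcumulant T)"
  unfolding dcumulant_def using T
  by (intro continuous_intros continuous_on_compose2[OF continuous_on_Jfun]) auto

lemma DERIV_cumulant:
  assumes "s > -(1-T)"
  shows "(cumulant T has_real_derivative dcumulant T s) (at s)"
proof -
  have "1 + s > 0" "1 - T + s > 0" using assms T by auto
  then show ?thesis
    unfolding cumulant_def dcumulant_def
    by (auto intro!: derivative_eq_intros DERIV_chain2[OF DERIV_Ffun] DERIV_chain2[OF DERIV_Jfun])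
qed

lemma DERIV_dcumulant:
  assumes "s > -(1-T)"
  shows "(dcumulant T has_real_derivative (ln (1 + s) - ln (1 - T + s) - T / (1 + s))) (at s)"
proof -
  have "1 + s > 0" "1 - T + s > 0" using assms T by auto
  then show ?thesis
    unfolding dcumulant_def
    by (auto intro!: derivative_eq_intros DERIV_chain2[OF DERIV_Jfun])
qed

text \<open>With v = (1 - T + s) / (1 + s) in (0,1) the derivative is v - 1 - ln v, which is
  positive. At s = -(1-T) only continuity is used, hence the criterion with derivatives on the open
  interval.\<close>

lemma dcumulant_strict_mono:
  assumes "-(1-T) \<le> s" "s < t"
  shows "dcumulant T s < dcumulant T t"
proof (rule DERIV_pos_imp_increasing_open[OF assms(2)])
  fix x assume x: "s < x" "x < t"
  then have p: "x > -(1-T)" using assms by auto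
  then have q: "1 + x > 0" "1 - T + x > 0" using T by auto
  have "(1 - T + x) / (1 + x) < 1" "(1 - T + x) / (1 + x) > 0"
    using q T by auto
  then have "ln ((1 - T + x) / (1 + x)) < (1 - T + x) / (1 + x) - 1"
    using ln_le_minus_one[of "(1 - T + x) / (1 + x)"] ln_eq_minus_one[of "(1 - T + x) / (1 + x)"]
    by linarith
  also have "(1 - T + x) / (1 + x) - 1 = - (T / (1 + x))"
    using q by (simp add: field_simps)
  finally have "ln (1 + x) - ln (1 - T + x) - T / (1 + x) > 0"
    using q by (simp add: ln_div)
  then show "\<exists>y. DERIV (dcumulant T) x :> y \<and> y > 0"
    using DERIV_dcumulant[OF p] by blast
next
  show "continuous_on {s..t} (dcumulant T)"
    by (rule continuous_on_subset[OF continuous_on_dcumulant]) (use assms in auto)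
qed

lemma dcumulant_mono:
  "-(1-T) \<le> s \<Longrightarrow> s \<le> t \<Longrightarrow> dcumulant T s \<le> dcumulant T t"
  using dcumulant_strict_mono[of s t] by (cases "s = t") auto

lemma dcumulant_left_end: "dcumulant T (-(1-T)) = -T"
  using T by (simp add: dcumulant_def Jfun_eq algebra_simps)

lemma dcumulant_tendsto_0: "(dcumulant T \<longlongrightarrow> 0) at_top"
  unfolding dcumulant_def Jfun_eq using T by real_asymp

text \<open>An increasing function with limit 0 at infinity is nonpositive; passing from s to s + 1
  makes the inequality strict.\<close>

lemma dcumulant_neg:
  assumes "-(1-T) \<le> s"
  shows "dcumulant T s < 0"
proof -
  have "eventually (\<lambda>u. dcumulant T (s + 1) \<le> dcumulant T u) at_top"
    using eventually_ge_at_top[of "s + 1"]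
    by eventually_elim (use assms dcumulant_mono in auto)
  then have "dcumulant T (s + 1) \<le> 0"
    by (intro tendsto_lowerbound[OF dcumulant_tendsto_0]) auto
  then show ?thesis
    using dcumulant_strict_mono[of s "s + 1"] assms by auto
qed

lemma dcumulant_surj:
  assumes "-T \<le> \<xi>" "\<xi> < 0"
  obtains \<theta> where "\<theta> \<ge> -(1-T)" "dcumulant T \<theta> = \<xi>"
proof -
  have "eventually (\<lambda>u. \<xi> < dcumulant T u) at_top"
    using order_tendstoD(1)[OF dcumulant_tendsto_0] assms by auto
  then have "eventually (\<lambda>u. \<xi> < dcumulant T u \<and> u \<ge> -(1-T)) at_top"
    using eventually_ge_at_top[of "-(1-T)"] by eventually_elim auto
  then obtain u where u: "\<xi> < dcumulant T u" "u \<ge> -(1-T)"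
    using eventually_happens'[OF trivial_limit_at_top_linorder] by blast
  have "\<exists>x. -(1-T) \<le> x \<and> x \<le> u \<and> dcumulant T x = \<xi>"
    by (rule IVT') (use u assms dcumulant_left_end
        continuous_on_subset[OF continuous_on_dcumulant, of "{-(1-T)..u}"] in auto)
  then show ?thesis using that by auto
qed

lemma dcumulant_eqD:
  "\<lbrakk>-(1-T) \<le> s; -(1-T) \<le> t; dcumulant T s = dcumulant T t\<rbrakk> \<Longrightarrow> s = t"
  using dcumulant_strict_mono[of s t] dcumulant_strict_mono[of t s]
  by (cases s t rule: linorder_cases) auto

lemma ex1_theta:
  assumes "-T \<le> \<xi>" "\<xi> < 0"
  shows "\<exists>!\<theta>. \<theta> \<ge> -(1-T) \<and> theta_eq T \<xi> \<theta>"
  using dcumulant_surj[OF assms] dcumulant_eqD unfolding theta_eq_iff by metis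

text \<open>Substituting \<xi> = \<Lambda>'(\<theta>) eliminates the definite description, because
  \<Lambda>' is injective. The core formula becomes the Legendre transform parametrised by its
  contact point.\<close>

lemma IG_core_dcumulant:
  assumes "\<theta> \<ge> -(1-T)"
  shows "IG_core T (dcumulant T \<theta>) = \<theta> * dcumulant T \<theta> - cumulant T \<theta>"
proof -
  have "(THE t. t \<ge> -(1-T) \<and> theta_eq T (dcumulant T \<theta>) t) = \<theta>"
    using assms dcumulant_eqD by (intro the_equality) (auto simp: theta_eq_iff)
  then show ?thesis
    by (simp add: IG_core_def cumulant_def)
qed

lemma IG_dcumulant:
  assumes "\<theta> \<ge> -(1-T)"
  shows "IG T (dcumulant T \<theta>) = ereal (\<theta> * dcumulant T \<theta> - cumulant T \<theta>)"
proof -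
  have "-T \<le> dcumulant T \<theta>"
    using dcumulant_mono[of "-(1-T)" \<theta>] assms dcumulant_left_end by auto
  then show ?thesis
    using dcumulant_neg[OF assms] IG_core_dcumulant[OF assms] by (simp add: IG_def)
qed

text \<open>The linear branch is s \<xi> - \<Lambda>(s) at the boundary point s = -(1-T), where the
  supremum over s is attained once \<xi> is at most the boundary slope -T.\<close>

lemma IG_le_minus_T:
  assumes "\<xi> \<le> -T"
  shows "IG T \<xi> = ereal (-(1-T) * \<xi> - cumulant T (-(1-T)))"
proof -
  have "IG_core T (-T) = (1-T) * T - cumulant T (-(1-T))"
    using IG_core_dcumulant[of "-(1-T)"] unfolding dcumulant_left_end by linarith
  then show ?thesis
    using assms T by (cases "\<xi> = -T") (auto simp: IG_def algebra_simps)
qed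

lemma cumulant_MVT:
  assumes "-(1-T) \<le> s" "s < t"
  obtains z where "s < z" "z < t" "cumulant T t - cumulant T s = (t - s) * dcumulant T z"
proof -
  have "\<exists>l z. s < z \<and> z < t \<and> DERIV (cumulant T) z :> l \<and>
          cumulant T t - cumulant T s = (t - s) * l"
    using assms
    by (intro MVT continuous_on_subset[OF continuous_on_cumulant])
       (auto simp: real_differentiable_def intro!: exI DERIV_cumulant)
  then obtain l z where z: "s < z" "z < t" "DERIV (cumulant T) z :> l"
    "cumulant T t - cumulant T s = (t - s) * l" by blast
  moreover have "l = dcumulant T z"
    using DERIV_unique[OF z(3) DERIV_cumulant] z assms by auto
  ultimately show ?thesis using that by blast
qed

lemma cumulant_tangent:
  assumes \<theta>: "\<theta> \<ge> -(1-T)" and s: "s \<ge> -(1-T)"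
  shows "cumulant T s \<ge> cumulant T \<theta> + dcumulant T \<theta> * (s - \<theta>)"
proof (cases \<theta> s rule: linorder_cases)
  case less
  obtain z where z: "\<theta> < z" "cumulant T s - cumulant T \<theta> = (s - \<theta>) * dcumulant T z"
    using cumulant_MVT[OF \<theta> less] by metis
  have "(s - \<theta>) * dcumulant T \<theta> \<le> (s - \<theta>) * dcumulant T z"
    using dcumulant_mono[OF \<theta>, of z] z less by (intro mult_left_mono) auto
  then show ?thesis using z by (simp add: algebra_simps)
next
  case greater
  obtain z where z: "s < z" "z < \<theta>" "cumulant T \<theta> - cumulant T s = (\<theta> - s) * dcumulant T z"
    using cumulant_MVT[OF s greater] by metis
  have "(\<theta> - s) * dcumulant T z \<le> (\<theta> - s) * dcumulant T \<theta>"
    using dcumulant_mono[of z \<theta>] z greater s by (intro mult_left_mono) auto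
  then show ?thesis using z by (simp add: algebra_simps)
qed simp

text \<open>This makes the rate infinite for \<xi> \<ge> 0, where s \<xi> - \<Lambda>(s) \<ge>
  -\<Lambda>(s) for s \<ge> 0. The growth is only logarithmic.\<close>

lemma cumulant_at_top: "filterlim (\<lambda>s. - cumulant T s) at_top at_top"
proof -
  \<comment> \<open>With v = 1 + s, writing ln (v - T) = ln v + ln (1 - T/v) leaves only the
    coefficient T^2/2 in front of ln v. The bracket tends to 0.\<close>
  define f where "f v = T\<^sup>2 / 2 * ln v + ((v-T)\<^sup>2/2 * ln (1-T/v) + v * T/2 - 3*T\<^sup>2/4)" for v
  have "filterlim f at_top at_top"
    unfolding f_def using T by real_asymp
  then have "filterlim (\<lambda>s. f (1 + s)) at_top at_top"
    by (rule filterlim_compose) real_asymp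
  then have "filterlim (\<lambda>s. (Ffun 1 - Ffun (1 - T)) + f (1 + s)) at_top at_top"
    by (intro filterlim_tendsto_add_at_top[OF tendsto_const])
  moreover have "eventually (\<lambda>s. (Ffun 1 - Ffun (1 - T)) + f (1 + s) = - cumulant T s) at_top"
    using eventually_gt_at_top[of 0]
  proof eventually_elim
    case (elim s)
    define v where "v = 1 + s"
    have v: "v > 0" "v - T > 0" using elim T by (auto simp: v_def)
    have *: "1 - T + s = v - T" by (simp add: v_def)
    have "ln (1 - T / v) = ln ((v - T) / v)"
      using v by (simp add: diff_divide_distrib)
    then have ln_eq: "ln (1 - T / v) = ln (v - T) - ln v"
      using v by (simp add: ln_div)
    \<comment> \<open>The logarithms are replaced by arbitrary reals, so that the identity is one
      between polynomials.\<close>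
    have "T\<^sup>2 / 2 * a + ((v-T)\<^sup>2/2 * (b - a) + v * T/2 - 3*T\<^sup>2/4) =
        T * (v * a - v + 1) - (v\<^sup>2 / 2 * a - 3 * v\<^sup>2 / 4 + v)
        + ((v - T)\<^sup>2 / 2 * b - 3 * (v - T)\<^sup>2 / 4 + (v - T))" for a b
      by (simp add: field_simps power2_eq_square)
    then have "f v = T * Jfun v - Ffun v + Ffun (v - T)"
      unfolding f_def ln_eq Jfun_eq Ffun_eq .
    then show ?case
      unfolding cumulant_def * v_def[symmetric] by simp
  qed
  ultimately show ?thesis
    by (rule filterlim_mono_eventually[OF _ order_refl order_refl])
qed

text \<open>Convexity puts \<Lambda> above its tangent at the contact point of \<xi>, or at the left
  end point when \<xi> \<le> -T. Together with \<open>less_IG_D\<close> this identifies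
  \<open>IG\<close> as the supremum of s \<xi> - \<Lambda>(s) over s > -(1-T).\<close>

lemma IG_ge:
  assumes s: "s > -(1-T)"
  shows "ereal (s * \<xi> - cumulant T s) \<le> IG T \<xi>"
proof -
  consider "\<xi> \<ge> 0" | "\<xi> \<le> -T" | "-T \<le> \<xi>" "\<xi> < 0" by linarith
  then show ?thesis
  proof cases
    case 2
    have "(s + (1-T)) * \<xi> \<le> (s + (1-T)) * (-T)"
      using 2 s by (intro mult_left_mono) auto
    then show ?thesis
      using cumulant_tangent[of "-(1-T)" s] s
      unfolding IG_le_minus_T[OF 2] dcumulant_left_end by (simp add: algebra_simps)
  next
    case 3
    then obtain \<theta> where "\<theta> \<ge> -(1-T)" "dcumulant T \<theta> = \<xi>"
      using dcumulant_surj by blast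
    then show ?thesis
      using IG_dcumulant[of \<theta>] cumulant_tangent[of \<theta> s] s by (simp add: algebra_simps)
  qed (simp add: IG_def)
qed

text \<open>A nearly optimal s is taken very large for \<xi> \<ge> 0, close to the left end for
  \<xi> \<le> -T, and equal to the contact point in between. The left end is excluded because the
  Laplace transforms are controlled only to its right.\<close>

lemma less_IG_D:
  assumes "ereal r < IG T \<xi>"
  obtains s where "s > -(1-T)" "r < s * \<xi> - cumulant T s"
proof -
  consider "\<xi> \<ge> 0" | "\<xi> \<le> -T" | "-T < \<xi>" "\<xi> < 0" by linarith
  then show ?thesis
  proof cases
    case 1
    have "eventually (\<lambda>s. r < - cumulant T s) at_top"
      using cumulant_at_top by (auto simp: filterlim_at_top_dense)
    then have "eventually (\<lambda>s. r < - cumulant T s \<and> s \<ge> 0) at_top"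
      using eventually_ge_at_top[of 0] by eventually_elim auto
    then obtain s where s: "r < - cumulant T s" "s \<ge> 0"
      using eventually_happens'[OF trivial_limit_at_top_linorder] by blast
    moreover have "0 \<le> s * \<xi>" using 1 s by simp
    ultimately show ?thesis using that[of s] T by auto
  next
    case 2
    have "continuous_on {-(1-T)..} (\<lambda>s. s * \<xi> - cumulant T s)"
      by (intro continuous_intros continuous_on_cumulant)
    then have "((\<lambda>s. s * \<xi> - cumulant T s) \<longlongrightarrow> -(1-T) * \<xi> - cumulant T (-(1-T)))
        (at_right (-(1-T)))"
      unfolding at_within_Ici_at_right[symmetric] continuous_on_def by blast
    moreover have "r < -(1-T) * \<xi> - cumulant T (-(1-T))"
      using assms unfolding IG_le_minus_T[OF 2] by simp
    ultimately have "eventually (\<lambda>s. r < s * \<xi> - cumulant T s) (at_right (-(1-T)))"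
      by (rule order_tendstoD(1))
    moreover have "eventually (\<lambda>s. s > -(1-T)) (at_right (-(1-T)))"
      by (rule eventually_at_right_less)
    ultimately have "eventually (\<lambda>s. r < s * \<xi> - cumulant T s \<and> s > -(1-T)) (at_right (-(1-T)))"
      by eventually_elim auto
    then obtain s where "r < s * \<xi> - cumulant T s \<and> s > -(1-T)"
      using eventually_happens'[OF trivial_limit_at_right_real] by blast
    then show ?thesis using that by blast
  next
    case 3
    then obtain \<theta> where \<theta>: "\<theta> \<ge> -(1-T)" "dcumulant T \<theta> = \<xi>"
      using dcumulant_surj[of \<xi>] by auto
    with 3 dcumulant_left_end have "\<theta> \<noteq> -(1-T)" by auto
    then show ?thesis
      using that[of \<theta>] \<theta> assms IG_dcumulant[of \<theta>] by auto
  qed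
qed

text \<open>To the right of the mean \<Lambda>'(0), Chernoff's inequality needs s \<ge> 0. If the s
  found is negative, the tangent at 0 forces r < 0, and then s = 0 serves because \<Lambda>(0) =
  0.\<close>

lemma less_IG_D_right:
  assumes "ereal r < IG T \<xi>" "\<xi> \<ge> dcumulant T 0"
  obtains s where "s \<ge> 0" "r < s * \<xi> - cumulant T s"
proof -
  obtain s where s: "s > -(1-T)" "r < s * \<xi> - cumulant T s"
    using less_IG_D[OF assms(1)] .
  show ?thesis
  proof (cases "s \<ge> 0")
    case False
    then have "s * \<xi> \<le> s * dcumulant T 0"
      using assms by (intro mult_left_mono_neg) auto
    then have "r < 0"
      using s cumulant_tangent[of 0 s] T by (auto simp: mult.commute)
    then show ?thesis using that[of 0] by simp
  qed (use that s in auto)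
qed

lemma less_IG_D_left:
  assumes "ereal r < IG T \<xi>" "\<xi> \<le> dcumulant T 0"
  obtains s where "s > -(1-T)" "s \<le> 0" "r < s * \<xi> - cumulant T s"
proof -
  obtain s where s: "s > -(1-T)" "r < s * \<xi> - cumulant T s"
    using less_IG_D[OF assms(1)] .
  show ?thesis
  proof (cases "s \<le> 0")
    case False
    then have "s * \<xi> \<le> s * dcumulant T 0"
      using assms by (intro mult_left_mono) auto
    then have "r < 0"
      using s cumulant_tangent[of 0 s] T by (auto simp: mult.commute)
    then show ?thesis using that[of 0] T by simp
  qed (use that s in auto)
qed

text \<open>By duality the set is an intersection of closed sets, one for each s. The two values s =
  -(1-T)/2 and s = 1, of opposite sign, already bound it from both sides.\<close>

lemma compact_sublevel_IG: "compact {\<xi>. IG T \<xi> \<le> ereal a}"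
proof -
  have eq: "{\<xi>. IG T \<xi> \<le> ereal a} = (\<Inter>s\<in>{-(1-T)<..}. {\<xi>. s * \<xi> - cumulant T s \<le> a})"
    (is "?L = ?R")
  proof (intro equalityI subsetI)
    fix \<xi> assume "\<xi> \<in> ?L"
    then have le: "IG T \<xi> \<le> ereal a" by simp
    have "s * \<xi> - cumulant T s \<le> a" if "s > -(1-T)" for s
      using order_trans[OF IG_ge[OF that] le] by simp
    then show "\<xi> \<in> ?R" by blast
  next
    fix \<xi> assume *: "\<xi> \<in> ?R"
    show "\<xi> \<in> ?L"
    proof (rule ccontr)
      assume "\<xi> \<notin> ?L"
      then have "ereal a < IG T \<xi>" by simp
      then obtain s where s: "s > -(1-T)" "a < s * \<xi> - cumulant T s"
        by (rule less_IG_D)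
      then have "s * \<xi> - cumulant T s \<le> a"
        using * by blast
      then show False using s by linarith
    qed
  qed
  have "closed ?L"
    unfolding eq by (intro closed_INT ballI closed_Collect_le continuous_intros)
  moreover have "?L \<subseteq> {- (2 * (a + cumulant T (-(1-T)/2)) / (1-T)) .. a + cumulant T 1}"
  proof
    fix \<xi> assume "\<xi> \<in> ?L"
    then have *: "s * \<xi> - cumulant T s \<le> a" if "s > -(1-T)" for s
      unfolding eq using that by blast
    have "-(1-T)/2 * \<xi> - cumulant T (-(1-T)/2) \<le> a" "1 * \<xi> - cumulant T 1 \<le> a"
      by (rule *, use T in simp)+
    then have "- \<xi> * (1-T) \<le> 2 * (a + cumulant T (-(1-T)/2))" "\<xi> \<le> a + cumulant T 1"
      by (auto simp: field_simps)
    moreover from this(1) have "- \<xi> \<le> 2 * (a + cumulant T (-(1-T)/2)) / (1-T)"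
      using T by (subst pos_le_divide_eq) auto
    ultimately show "\<xi> \<in> {- (2 * (a + cumulant T (-(1-T)/2)) / (1-T)) .. a + cumulant T 1}"
      by simp
  qed
  then have "bounded ?L"
    using bounded_subset[OF bounded_closed_interval] by blast
  ultimately show ?thesis
    by (simp add: compact_eq_bounded_closed)
qed

end

subsection \<open>Asymptotics of the Laplace transforms\<close>

text \<open>The increment of \<open>ln_Gamma\<close> from x to x + 1 is ln x by the functional
  equation and a value of \<open>Digamma\<close> in between by the mean value theorem;
  \<open>Digamma\<close> is increasing.\<close>

lemma Digamma_ln_bounds:
  assumes "x > (0::real)"
  shows "Digamma x \<le> ln x" "ln x \<le> Digamma (x + 1)"
proof -
  have "\<exists>z. z > x \<and> z < x + 1 \<and> ln_Gamma (x + 1) - ln_Gamma x = (x + 1 - x) * Digamma z"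
    using assms by (intro MVT2 has_field_derivative_ln_Gamma_real) auto
  then obtain z where z: "z > x" "z < x + 1" "ln_Gamma (x + 1) - ln_Gamma x = Digamma z"
    by auto
  have "Gamma (x + 1) = x * Gamma x"
    using assms by (intro Gamma_plus1) (auto elim!: nonpos_Ints_cases)
  then have "ln_Gamma (x + 1) - ln_Gamma x = ln x"
    using assms Gamma_real_pos[of x] by (simp add: ln_Gamma_real_pos ln_mult_pos)
  then show "Digamma x \<le> ln x" "ln x \<le> Digamma (x + 1)"
    using z assms Digamma_real_mono[of x z] Digamma_real_mono[of z "x + 1"] by auto
qed

text \<open>The error f has derivative \<open>Digamma y - ln y\<close>, which lies between -1/(y -
  1) and 0. Hence f decreases and f + ln (y - 1) increases on [2, x]. At the base point 2 the added
  logarithm vanishes and f 2 = 2 - 2 ln 2 lies in [0,1].\<close>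

lemma ln_Gamma_approx:
  assumes x: "x \<ge> (2::real)"
  shows "\<bar>ln_Gamma x - (x * ln x - x)\<bar> \<le> 1 + ln x"
proof -
  define f where "f x = ln_Gamma x - (x * ln x - x)" for x :: real
  have f': "(f has_real_derivative (Digamma y - ln y)) (at y)" if "y > 0" for y
    unfolding f_def using that by (auto intro!: derivative_eq_intros)
  have "ln_Gamma (2::real) = 0"
    using ln_Gamma_real_conv_fact[of 2] by simp
  moreover have "1 / 2 \<le> ln (2::real)" "ln (2::real) \<le> 1"
    using ln_le_minus_one[of "1/2"] ln_le_minus_one[of 2] by (auto simp: ln_div)
  ultimately have f2: "0 \<le> f 2" "f 2 \<le> 1"
    by (auto simp: f_def)
  have "f x \<le> f 2"
  proof (rule DERIV_nonpos_imp_nonincreasing[OF x])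
    fix y :: real assume "2 \<le> y" "y \<le> x"
    then show "\<exists>d. DERIV f y :> d \<and> d \<le> 0"
      using f'[of y] Digamma_ln_bounds(1)[of y] by (intro exI conjI) auto
  qed
  moreover have "f 2 + ln (2 - 1) \<le> f x + ln (x - 1)"
  proof (rule DERIV_nonneg_imp_nondecreasing[OF x])
    fix y :: real assume y: "2 \<le> y" "y \<le> x"
    have "ln (y / (y - 1)) \<le> y / (y - 1) - 1"
      using y by (intro ln_le_minus_one) auto
    also have "y / (y - 1) - 1 = 1 / (y - 1)"
      using y by (simp add: field_simps)
    finally have "ln y - ln (y - 1) \<le> 1 / (y - 1)"
      using y by (simp add: ln_div)
    then have "Digamma y - ln y + 1 / (y - 1) \<ge> 0"
      using Digamma_ln_bounds(2)[of "y - 1"] y by auto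
    moreover have "((\<lambda>y. f y + ln (y - 1)) has_real_derivative Digamma y - ln y + 1 / (y - 1)) (at y)"
      using y by (auto intro!: derivative_eq_intros f')
    ultimately show "\<exists>d. ((\<lambda>y. f y + ln (y - 1)) has_real_derivative d) (at y) \<and> d \<ge> 0"
      by blast
  qed
  moreover have "ln (x - 1) \<le> ln x" "0 \<le> ln x" using x by auto
  ultimately show ?thesis
    using f2 unfolding f_def[symmetric] by simp
qed

text \<open>The scale-dependent term \<open>N * y * ln N\<close> is kept apart because it cancels
  between the four Gamma functions of a Beta quotient. The bound C makes the error uniform in
  y.\<close>

lemma ln_Gamma_mult_approx:
  assumes "N > 0" "y > 0" "N * y \<ge> 2" "y \<le> C"
  shows "\<bar>ln_Gamma (N * y) - (N * (Jfun y - 1) + N * y * ln N)\<bar> \<le> 1 + ln (N * C)"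
proof -
  have "N * y * ln (N * y) - N * y = N * (Jfun y - 1) + N * y * ln N"
    using assms by (simp add: Jfun_eq ln_mult algebra_simps)
  moreover have "ln (N * y) \<le> ln (N * C)"
    using assms by (subst ln_le_cancel_iff) auto
  ultimately show ?thesis
    using ln_Gamma_approx[OF assms(3)] by linarith
qed

text \<open>With \<open>b = \<beta> / 2\<close> this is the logarithm of the Laplace transform of
  \<open>\<Sum>k=2..m. ln (\<rho> n k)\<close> at \<open>b * n * s\<close>.\<close>
definition log_mgf :: "real \<Rightarrow> nat \<Rightarrow> nat \<Rightarrow> real \<Rightarrow> real" where
  "log_mgf b n m s = (\<Sum>k=2..m. ln (Beta (b * real (n - k + 1) + b * real n * s) (b * real (k - 1))
      / Beta (b * real (n - k + 1)) (b * real (k - 1))))"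

lemma ln_Beta_ratio:
  assumes "a > 0" "b > 0" "a + t > (0::real)"
  shows "ln (Beta (a + t) b / Beta a b) =
    ln_Gamma (a + t) + ln_Gamma (a + b) - ln_Gamma a - ln_Gamma (a + b + t)"
proof -
  have "Gamma a > 0" "Gamma b > 0" "Gamma (a + t) > 0" "Gamma (a + b) > 0" "Gamma (a + b + t) > 0"
    using assms by auto
  then have "Gamma a \<noteq> 0" "Gamma b \<noteq> 0" "Gamma (a + t) \<noteq> 0" "Gamma (a + b) \<noteq> 0"
      "Gamma (a + b + t) \<noteq> 0"
    by linarith+
  moreover have "Beta (a + t) b = Gamma (a + t) * Gamma b / Gamma (a + b + t)"
      "Beta a b = Gamma a * Gamma b / Gamma (a + b)"
    by (simp_all add: Beta_def add_ac)
  ultimately show ?thesis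
    using assms by (simp add: ln_Gamma_real_pos ln_mult ln_div)
qed

text \<open>Differentiating in the time variable gives the leading term of one summand of
  \<open>log_mgf\<close>, so the sum over k is a Riemann sum for \<Lambda>.\<close>

lemma DERIV_cumulant_left:
  assumes "u < 1" "u < 1 + s"
  shows "((\<lambda>u. cumulant u s) has_real_derivative (Jfun (1 - u + s) - Jfun (1 - u) - Jfun (1 + s))) (at u)"
  unfolding cumulant_def using assms
  by (auto intro!: derivative_eq_intros DERIV_chain2[OF DERIV_Ffun])

text \<open>On each cell the increment of f is f' at an interior point over n, and moving that point
  to the right end costs at most K / n^2. The sum has its nodes at 1/n, ..., (m-1)/n, so the
  telescoped increment ends at (m-1)/n. The base case m = 1 has an empty sum and only needs K \<ge>
  0.\<close>

lemma riemann_sum_error: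
  fixes f f' f'' :: "real \<Rightarrow> real"
  assumes f: "\<And>u. 0 \<le> u \<Longrightarrow> u \<le> T \<Longrightarrow> (f has_real_derivative f' u) (at u)"
    and f': "\<And>u. 0 \<le> u \<Longrightarrow> u \<le> T \<Longrightarrow> (f' has_real_derivative f'' u) (at u)"
    and f'': "\<And>u. 0 \<le> u \<Longrightarrow> u \<le> T \<Longrightarrow> \<bar>f'' u\<bar> \<le> K"
    and m: "1 \<le> m" "real m \<le> real n * T"
  shows "\<bar>(\<Sum>k=2..m. f' (real (k - 1) / n)) / n - (f (real (m - 1) / n) - f 0)\<bar> \<le> K * m / n\<^sup>2"
  using m
proof (induction m rule: nat_induct_at_least)
  case base
  have "T \<ge> 0"
    using base mult_nonneg_nonpos[of "real n" T] by linarith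
  then have "K \<ge> 0" using f''[of 0] by auto
  then show ?case by simp
next
  case (Suc m)
  have n: "n > 0" using Suc.prems by (cases n) auto
  have le: "real m / n \<le> T" using Suc.prems n by (simp add: field_simps)
  have eq: "real (m - 1) / n = real m / n - 1 / n" using Suc.hyps n by (simp add: diff_divide_distrib of_nat_diff)
  have pos: "real (m - 1) / n \<ge> 0" by simp
  have "\<exists>z. z > real (m-1)/n \<and> z < real m / n \<and>
      f (real m / n) - f (real (m - 1) / n) = (real m / n - real (m - 1) / n) * f' z"
    using le n eq pos by (intro MVT2 f) auto
  then obtain z where z: "z > real (m-1)/n" "z < real m / n"
      "f (real m / n) - f (real (m - 1) / n) = f' z / n"
    unfolding eq by auto
  have "\<exists>y. y > z \<and> y < real m / n \<and> f' (real m / n) - f' z = (real m / n - z) * f'' y"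
    using z(1,2) le order.strict_trans1[OF pos z(1)] by (intro MVT2 f') auto
  then obtain y where y: "y > z" "y < real m / n" "f' (real m / n) - f' z = (real m / n - z) * f'' y"
    by auto
  have "\<bar>f' (real m / n) - f' z\<bar> \<le> 1 / n * K"
    unfolding y abs_mult using z eq y le pos by (intro mult_mono f'') auto
  then have "\<bar>f' (real m / n) - f' z\<bar> / n \<le> K / n\<^sup>2"
    using n by (simp add: field_simps power2_eq_square)
  then have "\<bar>f' (real m / n) / n - (f (real m / n) - f (real (m - 1) / n))\<bar> \<le> K / n\<^sup>2"
    unfolding z using n by (simp add: diff_divide_distrib[symmetric] abs_divide)
  moreover have "(\<Sum>k=2..Suc m. f' (real (k - 1) / n)) / n
      = (\<Sum>k=2..m. f' (real (k - 1) / n)) / n + f' (real m / n) / n"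
    using Suc.hyps by (simp add: add_divide_distrib)
  moreover have "K * real (Suc m) / n\<^sup>2 = K * m / n\<^sup>2 + K / n\<^sup>2"
    by (simp add: algebra_simps add_divide_distrib)
  moreover have "\<bar>(\<Sum>k=2..m. f' (real (k - 1) / n)) / n - (f (real (m - 1) / n) - f 0)\<bar> \<le> K * m / n\<^sup>2"
    using Suc by auto
  ultimately show ?case by simp
qed

text \<open>Each factor contributes four Stirling errors. The two lower bounds on n keep every Gamma
  argument that is approximated at least 2, uniformly in k.\<close>

lemma log_mgf_error:
  assumes b: "b > 0" and s: "s > -(1-T)" and T: "0 < T" "T < 1"
    and m: "real m \<le> real n * T"
    and n: "b * real n * (1-T) \<ge> 2" "b * real n * (1 - T + s) \<ge> 2"
  shows "\<bar>log_mgf b n m s - b * n * (\<Sum>k=2..m. Jfun (1 - real (k - 1) / n + s) - Jfun (1 - real (k - 1) / n) - Jfun (1 + s))\<bar>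
    \<le> real m * (4 * (1 + ln (b * n * (1 + \<bar>s\<bar>))))"
proof -
  define N where "N = b * real n"
  have "n > 0" using n(1) by (cases n) auto
  then have N: "N > 0" using b by (simp add: N_def)
  define C where "C = 1 + \<bar>s\<bar>"
  define err where "err = 1 + ln (N * C)"
  have "N * (1 + s) \<ge> 2"
    using n(2) T N mult_left_mono[of "1 - T + s" "1 + s" N] by (simp add: N_def)
  have "N * 1 \<ge> 2"
    using n(1) T N mult_left_mono[of "1 - T" 1 N] by (simp add: N_def)
  have "err \<ge> 0"
  proof -
    have "N * 1 \<le> N * C" using N by (intro mult_left_mono) (auto simp: C_def)
    then show ?thesis using \<open>N * 1 \<ge> 2\<close> unfolding err_def by (intro add_nonneg_nonneg ln_ge_zero) linarith+
  qed
  have "\<bar>ln (Beta (b * real (n - k + 1) + b * real n * s) (b * real (k - 1)) / Beta (b * real (n - k + 1)) (b * real (k - 1)))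
      - N * (Jfun (1 - real (k - 1) / n + s) - Jfun (1 - real (k - 1) / n) - Jfun (1 + s))\<bar> \<le> 4 * err"
    if k: "k \<in> {2..m}" for k
  proof -
    define u where "u = real (k - 1) / n"
    have "real m \<le> real n * 1" using m T mult_left_mono[of T 1 "real n"] by linarith
    then have "k \<le> n" using k by auto
    have u: "u \<ge> 0" "u < T" using k m \<open>n > 0\<close> unfolding u_def by (auto simp: field_simps of_nat_diff)
    have e1: "b * real (n - k + 1) = N * (1 - u)"
      and e2: "b * real (k - 1) = N * u"
      and e3: "b * real (n - k + 1) + b * real n * s = N * (1 - u + s)"
      using \<open>n > 0\<close> \<open>k \<le> n\<close> k unfolding N_def u_def by (auto simp: field_simps of_nat_diff)
    have e4: "N * (1 - u) + N * u = N * 1" "N * 1 + N * s = N * (1 + s)" "N * (1 - u) + N * s = N * (1 - u + s)"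
      by (auto simp: algebra_simps)
    have up: "u > 0" using k \<open>n > 0\<close> by (auto simp: u_def)
    have p1: "N * (1 - u) \<ge> 2" 
      using n(1) N u mult_left_mono[of "1 - T" "1 - u" N] by (simp add: N_def)
    have p2: "N * (1 - u + s) \<ge> 2"
      using n(2) N u mult_left_mono[of "1 - T + s" "1 - u + s" N] by (simp add: N_def)
    have ln_eq: "ln (Beta (N * (1 - u) + N * s) (N * u) / Beta (N * (1 - u)) (N * u)) =
        ln_Gamma (N * (1 - u + s)) + ln_Gamma (N * 1) - ln_Gamma (N * (1 - u)) - ln_Gamma (N * (1 + s))"
      using ln_Beta_ratio[of "N * (1 - u)" "N * u" "N * s"] mult_pos_pos[OF N up] p1 p2
      unfolding e4 by linarith
    have "\<bar>ln_Gamma (N * (1 - u + s)) - (N * (Jfun (1 - u + s) - 1) + N * (1 - u + s) * ln N)\<bar> \<le> err"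
      unfolding err_def using u s T by (intro ln_Gamma_mult_approx N p2) (auto simp: C_def)
    moreover have "\<bar>ln_Gamma (N * 1) - (N * (Jfun 1 - 1) + N * 1 * ln N)\<bar> \<le> err"
      unfolding err_def using \<open>N * 1 \<ge> 2\<close> by (intro ln_Gamma_mult_approx N) (auto simp: C_def)
    moreover have "\<bar>ln_Gamma (N * (1 - u)) - (N * (Jfun (1 - u) - 1) + N * (1 - u) * ln N)\<bar> \<le> err"
      unfolding err_def using u T by (intro ln_Gamma_mult_approx N p1) (auto simp: C_def)
    moreover have "\<bar>ln_Gamma (N * (1 + s)) - (N * (Jfun (1 + s) - 1) + N * (1 + s) * ln N)\<bar> \<le> err"
      unfolding err_def using s T by (intro ln_Gamma_mult_approx N \<open>N * (1 + s) \<ge> 2\<close>) (auto simp: C_def)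
    \<comment> \<open>The signed arguments satisfy (1-u+s) + 1 - (1-u) - (1+s) = 0, so the terms
      with ln N cancel, and J(1) = 0.\<close>
    moreover have "N * (Jfun (1 - u + s) - Jfun (1 - u) - Jfun (1 + s)) =
        (N * (Jfun (1 - u + s) - 1) + N * (1 - u + s) * ln N) + (N * (Jfun 1 - 1) + N * 1 * ln N)
        - (N * (Jfun (1 - u) - 1) + N * (1 - u) * ln N) - (N * (Jfun (1 + s) - 1) + N * (1 + s) * ln N)"
      by (simp add: algebra_simps Jfun_eq[of 1])
    ultimately show ?thesis
      unfolding u_def[symmetric] N_def[symmetric] e1 e2 ln_eq by linarith
  qed
  then have "\<bar>log_mgf b n m s - N * (\<Sum>k=2..m. Jfun (1 - real (k - 1) / n + s) - Jfun (1 - real (k - 1) / n) - Jfun (1 + s))\<bar>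
     \<le> (\<Sum>k=2..m. 4 * err)"
    unfolding log_mgf_def sum_distrib_left sum_subtractf[symmetric]
    by (intro order_trans[OF sum_abs] sum_mono) auto
  also have "\<dots> \<le> real m * (4 * err)"
    using \<open>err \<ge> 0\<close> by (auto intro!: mult_right_mono)
  finally show ?thesis
    by (simp add: N_def err_def C_def)
qed

text \<open>After division by b n^2 the Stirling errors are O(ln n / n) and the Riemann error is
  O(1/n). The sequence m is left general because both the full sum and the sum without its last term
  are needed.\<close>

lemma log_mgf_tendsto:
  assumes b: "b > 0" and s: "s > -(1-T)" and T: "0 < T" "T < 1"
    and m: "\<And>n. real (m n) \<le> real n * T" and lim: "(\<lambda>n. real (m n) / n) \<longlonglongrightarrow> T"
  shows "(\<lambda>n. log_mgf b n (m n) s / (b * (real n)\<^sup>2)) \<longlonglongrightarrow> cumulant T s"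
proof -
  define \<phi> where "\<phi> u = Jfun (1 - u + s) - Jfun (1 - u) - Jfun (1 + s)" for u
  define \<phi>' where "\<phi>' u = ln (1 - u) - ln (1 - u + s)" for u
  define C where "C = 1 + \<bar>s\<bar>"
  have "continuous_on {0..T} \<phi>'"
    unfolding \<phi>'_def using T s by (intro continuous_intros) auto
  then have "bounded (\<phi>' ` {0..T})"
    by (intro compact_imp_bounded compact_continuous_image) auto
  then obtain K where K: "\<And>u. 0 \<le> u \<Longrightarrow> u \<le> T \<Longrightarrow> \<bar>\<phi>' u\<bar> \<le> K"
    by (fastforce simp: bounded_iff)
  have d1: "((\<lambda>u. cumulant u s) has_real_derivative \<phi> u) (at u)" if "0 \<le> u" "u \<le> T" for u
    unfolding \<phi>_def using that T s by (intro DERIV_cumulant_left) auto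
  have d2: "(\<phi> has_real_derivative \<phi>' u) (at u)" if "0 \<le> u" "u \<le> T" for u
    unfolding \<phi>_def \<phi>'_def using that T s
    by (auto intro!: derivative_eq_intros DERIV_chain2[OF DERIV_Jfun])
  have "K \<ge> 0" using K[of 0] T by auto
  have ev1: "eventually (\<lambda>n. m n \<ge> 1) sequentially"
  proof -
    have "eventually (\<lambda>n. real (m n) / n > 0) sequentially"
      using lim T by (intro order_tendstoD) auto
    then show ?thesis by eventually_elim (auto simp: Suc_le_eq intro: Nat.gr0I)
  qed
  have ev2: "eventually (\<lambda>n. b * real n * (1-T) \<ge> 2) sequentially"
    using b T by real_asymp
  have ev3: "eventually (\<lambda>n. b * real n * (1-T+s) \<ge> 2) sequentially"
  proof -
    have "1 - T + s > 0" using s by simp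
    then show ?thesis using b by real_asymp
  qed
  \<comment> \<open>The Riemann sum stops at \<open>(m n - 1) / n\<close>; continuity in the time
    variable then moves this end point to T.\<close>
  have "(\<lambda>n. log_mgf b n (m n) s / (b * (real n)\<^sup>2) - cumulant (real (m n - 1) / n) s) \<longlonglongrightarrow> 0"
  proof (rule Lim_null_comparison)
    show "eventually (\<lambda>n. norm (log_mgf b n (m n) s / (b * (real n)\<^sup>2) - cumulant (real (m n - 1) / n) s)
        \<le> 4 * (1 + ln (b * n * C)) / (b * n) + K / n) sequentially"
      using ev1 ev2 ev3
    proof eventually_elim
      case (elim n)
      have n: "n > 0" using elim by (cases n) auto
      have "real (m n) \<le> real n * 1" using m[of n] T mult_left_mono[of T 1 "real n"] by linarith
      then have mn: "real (m n) \<le> real n" by simp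
      define S where "S = (\<Sum>k=2..m n. \<phi> (real (k - 1) / n))"
      have err: "4 * (1 + ln (b * n * C)) \<ge> 0"
      proof -
        have "b * n * (1-T) \<le> b * n * C" using b n T by (intro mult_left_mono) (auto simp: C_def)
        then have "ln (b * n * C) \<ge> 0" using elim by (intro ln_ge_zero) auto
        then show ?thesis by simp
      qed
      have "\<bar>log_mgf b n (m n) s - b * n * S\<bar> \<le> m n * (4 * (1 + ln (b * n * C)))"
        unfolding S_def \<phi>_def C_def using log_mgf_error[OF b s T m elim(2,3)] .
      also have "\<dots> \<le> n * (4 * (1 + ln (b * n * C)))"
        using mn err by (intro mult_right_mono) auto
      finally have "\<bar>log_mgf b n (m n) s - b * n * S\<bar> / (b * (real n)\<^sup>2)
          \<le> n * (4 * (1 + ln (b * n * C))) / (b * (real n)\<^sup>2)"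
        using b by (intro divide_right_mono) auto
      also have "n * (4 * (1 + ln (b * n * C))) / (b * (real n)\<^sup>2) = 4 * (1 + ln (b * n * C)) / (b * n)"
        using n b by (simp add: field_simps power2_eq_square)
      also have "\<bar>log_mgf b n (m n) s - b * n * S\<bar> / (b * (real n)\<^sup>2) = \<bar>(log_mgf b n (m n) s - b * n * S) / (b * (real n)\<^sup>2)\<bar>"
        using n b by (simp add: abs_mult)
      also have "(log_mgf b n (m n) s - b * n * S) / (b * (real n)\<^sup>2) = log_mgf b n (m n) s / (b * (real n)\<^sup>2) - S / n"
        using n b by (simp add: field_simps power2_eq_square)
      finally have 1: "\<bar>log_mgf b n (m n) s / (b * (real n)\<^sup>2) - S / n\<bar> \<le> 4 * (1 + ln (b * n * C)) / (b * n)" .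
      have "\<bar>S / n - (cumulant (real (m n - 1) / n) s - cumulant 0 s)\<bar> \<le> K * m n / n\<^sup>2"
        unfolding S_def using riemann_sum_error[of T "\<lambda>u. cumulant u s" \<phi> \<phi>' K "m n" n] d1 d2 K elim m by blast
      also have "\<dots> \<le> K * n / n\<^sup>2"
        using mn \<open>K \<ge> 0\<close> by (intro divide_right_mono mult_left_mono) auto
      also have "\<dots> = K / n" using n by (simp add: power2_eq_square)
      finally have "\<bar>S / n - cumulant (real (m n - 1) / n) s\<bar> \<le> K / n"
        by (simp add: cumulant_def)
      with 1 show ?case by simp
    qed
    show "(\<lambda>n. 4 * (1 + ln (b * real n * C)) / (b * n) + K / n) \<longlonglongrightarrow> 0"
    proof -
      have "C > 0" by (simp add: C_def)
      then show ?thesis using b by real_asymp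
    qed
  qed
  moreover have "(\<lambda>n. cumulant (real (m n - 1) / n) s) \<longlonglongrightarrow> cumulant T s"
  proof (rule isCont_tendsto_compose[where g = "\<lambda>u. cumulant u s"])
    show "isCont (\<lambda>u. cumulant u s) T"
      using d1[of T] T DERIV_isCont by auto
    have "(\<lambda>n. real (m n) / n - 1 / n) \<longlonglongrightarrow> T - 0"
      by (intro tendsto_diff lim lim_1_over_n)
    moreover have "eventually (\<lambda>n. real (m n) / n - 1 / n = real (m n - 1) / n) sequentially"
      using ev1 by eventually_elim (simp add: of_nat_diff diff_divide_distrib)
    ultimately show "(\<lambda>n. real (m n - 1) / n) \<longlonglongrightarrow> T"
      by (simp add: tendsto_cong)
  qed
  ultimately have "(\<lambda>n. (log_mgf b n (m n) s / (b * (real n)\<^sup>2) - cumulant (real (m n - 1) / n) s)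
      + cumulant (real (m n - 1) / n) s) \<longlonglongrightarrow> 0 + cumulant T s"
    by (rule tendsto_add)
  then show ?thesis by simp
qed

subsection \<open>Exponential bounds from limits of scaled cumulants\<close>

text \<open>The setting of the Gaertner-Ellis theorem. Nonnegative integrals in \<open>mgf\<close>
  encode finiteness together with the value.\<close>

locale scaled_cumulants =
  fixes M :: "nat \<Rightarrow> 'a measure" and X :: "nat \<Rightarrow> 'a \<Rightarrow> real" and a :: "nat \<Rightarrow> real"
    and L :: "nat \<Rightarrow> real \<Rightarrow> real" and \<Lambda> :: "real \<Rightarrow> real" and D :: "real set"
  assumes prob_space_M: "\<And>n. prob_space (M n)"
    and X_measurable [measurable]: "\<And>n. X n \<in> borel_measurable (M n)"
    and speed: "filterlim a at_top sequentially"
    and mgf: "\<And>s. s \<in> D \<Longrightarrow> eventually (\<lambda>n.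
      (\<integral>\<^sup>+\<omega>. ennreal (exp (a n * s * X n \<omega>)) \<partial>M n) = ennreal (exp (a n * L n s))) sequentially"
    and L_tendsto: "\<And>s. s \<in> D \<Longrightarrow> (\<lambda>n. L n s) \<longlonglongrightarrow> \<Lambda> s"
    and open_D: "open D"
begin

lemma speed_gt: "eventually (\<lambda>n. a n > c) sequentially"
  using speed by (auto simp: filterlim_at_top_dense)

text \<open>Markov's inequality for an exponential under the weight exp (a \<theta> X). Multiplying
  by t covers right half-lines for t > 0 and left ones for t < 0; \<theta> = 0 is the usual Chernoff
  bound.\<close>

lemma nn_integral_tilted_halfline:
  assumes "(\<integral>\<^sup>+\<omega>. ennreal (exp (a n * (\<theta> + t) * X n \<omega>)) \<partial>M n) = ennreal (exp (a n * L n (\<theta> + t)))"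
    and a: "a n > 0"
  shows "(\<integral>\<^sup>+\<omega>. ennreal (exp (a n * \<theta> * X n \<omega>)) * indicator {\<omega> \<in> space (M n). t * y \<le> t * X n \<omega>} \<omega> \<partial>M n)
    \<le> ennreal (exp (a n * (L n (\<theta> + t) - t * y)))"
proof -
  have "(\<integral>\<^sup>+\<omega>. ennreal (exp (a n * \<theta> * X n \<omega>)) * indicator {\<omega> \<in> space (M n). t * y \<le> t * X n \<omega>} \<omega> \<partial>M n)
      \<le> (\<integral>\<^sup>+\<omega>. ennreal (exp (- a n * t * y)) * ennreal (exp (a n * (\<theta> + t) * X n \<omega>)) \<partial>M n)"
  proof (rule nn_integral_mono)
    fix \<omega> assume "\<omega> \<in> space (M n)"
    have "exp (a n * \<theta> * X n \<omega>) \<le> exp (- a n * t * y) * exp (a n * (\<theta> + t) * X n \<omega>)"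
      if "t * y \<le> t * X n \<omega>"
      using mult_left_mono[OF that, of "a n"] a
      by (simp add: exp_add[symmetric] algebra_simps)
    then show "ennreal (exp (a n * \<theta> * X n \<omega>)) * indicator {\<omega> \<in> space (M n). t * y \<le> t * X n \<omega>} \<omega>
        \<le> ennreal (exp (- a n * t * y)) * ennreal (exp (a n * (\<theta> + t) * X n \<omega>))"
      by (auto simp: indicator_def ennreal_mult[symmetric] intro!: ennreal_leI)
  qed
  also have "\<dots> = ennreal (exp (- a n * t * y)) * ennreal (exp (a n * L n (\<theta> + t)))"
    using assms(1) by (subst nn_integral_cmult) auto
  also have "\<dots> = ennreal (exp (a n * (L n (\<theta> + t) - t * y)))"
    by (simp add: ennreal_mult[symmetric] exp_add[symmetric] algebra_simps)
  finally show ?thesis .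
qed

lemma chernoff_upper_bound:
  assumes t: "t \<in> D" and r: "r < t * y - \<Lambda> t"
  shows "eventually (\<lambda>n. measure (M n) {\<omega> \<in> space (M n). t * y \<le> t * X n \<omega>} \<le> exp (- a n * r)) sequentially"
proof -
  have "eventually (\<lambda>n. L n t < t * y - r) sequentially"
    using order_tendstoD(2)[OF L_tendsto[OF t]] r by auto
  then show ?thesis
    using mgf[OF t] speed_gt[of 0]
  proof eventually_elim
    case (elim n)
    interpret prob_space "M n" by (rule prob_space_M)
    have "emeasure (M n) {\<omega> \<in> space (M n). t * y \<le> t * X n \<omega>} \<le> ennreal (exp (a n * (L n t - t * y)))"
      using nn_integral_tilted_halfline[of n 0 t y] elim by simp
    also have "\<dots> \<le> ennreal (exp (- a n * r))"
      using elim mult_left_mono[of "L n t" "t * y - r" "a n"] 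
      by (intro ennreal_leI) (simp add: algebra_simps)
    finally show ?case
      unfolding emeasure_eq_measure by (subst (asm) ennreal_le_iff) auto
  qed
qed

text \<open>Exponential tilting by \<open>\<theta>\<close> without introducing the tilted measure: the tilted mass outside
  a neighbourhood of \<open>\<Lambda>' \<theta>\<close> is bounded by Chernoff's inequality at \<open>\<theta> \<plusminus> t\<close>.\<close>
lemma tilting_lower_bound:
  assumes \<theta>: "\<theta> \<in> D" and deriv: "(\<Lambda> has_real_derivative x) (at \<theta>)"
    and \<delta>: "\<delta> > 0" and r: "\<theta> * x - \<Lambda> \<theta> < r"
  shows "eventually (\<lambda>n. exp (- a n * r) \<le> measure (M n) {\<omega> \<in> space (M n). \<bar>X n \<omega> - x\<bar> < \<delta>}) sequentially"
proof -
  \<comment> \<open>On a ball of radius \<epsilon> the term \<theta> X varies by at most |\<theta>|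
    \<epsilon>, which uses up at most half of the slack in r. The added 1 keeps the denominator
    positive for \<theta> = 0.\<close>
  define \<epsilon> where "\<epsilon> = min \<delta> ((r - (\<theta> * x - \<Lambda> \<theta>)) / (2 * (\<bar>\<theta>\<bar> + 1)))"
  have \<epsilon>: "\<epsilon> > 0" "\<epsilon> \<le> \<delta>" using \<delta> r by (auto simp: \<epsilon>_def)
  have "\<bar>\<theta>\<bar> * \<epsilon> \<le> (\<bar>\<theta>\<bar> + 1) * ((r - (\<theta> * x - \<Lambda> \<theta>)) / (2 * (\<bar>\<theta>\<bar> + 1)))"
    using \<epsilon> by (intro mult_mono) (auto simp: \<epsilon>_def)
  also have "\<dots> = (r - (\<theta> * x - \<Lambda> \<theta>)) / 2"
    by (simp add: field_simps)
  finally have \<epsilon>r: "\<theta> * x + \<bar>\<theta>\<bar> * \<epsilon> - \<Lambda> \<theta> < r"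
    using r by (simp add: field_simps)
  have "((\<lambda>h. (\<Lambda> (\<theta> + h) - \<Lambda> \<theta>) / h) \<longlongrightarrow> x) (at 0)"
    using deriv by (simp add: DERIV_def)
  then have "eventually (\<lambda>h. dist ((\<Lambda> (\<theta> + h) - \<Lambda> \<theta>) / h) x < \<epsilon>) (at 0)"
    using \<epsilon>(1) by (rule tendstoD)
  then obtain d1 where d1: "d1 > 0" "\<And>h. h \<noteq> 0 \<Longrightarrow> \<bar>h\<bar> < d1 \<Longrightarrow> \<bar>(\<Lambda> (\<theta> + h) - \<Lambda> \<theta>) / h - x\<bar> < \<epsilon>"
    by (auto simp: eventually_at dist_real_def)
  obtain d2 where d2: "d2 > 0" "\<And>y. dist y \<theta> < d2 \<Longrightarrow> y \<in> D"
    using open_D \<theta> by (auto simp: open_dist)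
  define t where "t = min d1 d2 / 2"
  have t: "t > 0" "t < d1" "t < d2" using d1(1) d2(1) by (auto simp: t_def)
  \<comment> \<open>The sign of h selects the tail. Since \<Lambda>(\<theta> + h) -
    \<Lambda>(\<theta>) < h x + |h| \<epsilon> for small h, the tail is exponentially small relative
    to the total tilted mass, eventually below a quarter of it.\<close>
  have tail: "eventually (\<lambda>n. (\<integral>\<^sup>+\<omega>. ennreal (exp (a n * \<theta> * X n \<omega>)) *
      indicator {\<omega> \<in> space (M n). h * (x + sgn h * \<epsilon>) \<le> h * X n \<omega>} \<omega> \<partial>M n)
      \<le> ennreal (exp (a n * L n \<theta>) / 4)) sequentially" if h: "\<bar>h\<bar> = t" for h
  proof -
    have h': "h \<noteq> 0" "\<theta> + h \<in> D" using h t by (auto intro!: d2 simp: dist_real_def)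
    have "\<bar>(\<Lambda> (\<theta> + h) - \<Lambda> \<theta>) / h - x\<bar> < \<epsilon>"
      using h h' t by (intro d1) auto
    then have "\<bar>(\<Lambda> (\<theta> + h) - \<Lambda> \<theta>) / h - x\<bar> * \<bar>h\<bar> < \<epsilon> * \<bar>h\<bar>"
      using h t by (intro mult_strict_right_mono) auto
    moreover have "(q / h - x) * h = q - h * x" for q
      using h' by (simp add: left_diff_distrib)
    then have "\<bar>(\<Lambda> (\<theta> + h) - \<Lambda> \<theta>) / h - x\<bar> * \<bar>h\<bar> = \<bar>\<Lambda> (\<theta> + h) - \<Lambda> \<theta> - h * x\<bar>"
      unfolding abs_mult[symmetric] by simp
    ultimately have "\<Lambda> (\<theta> + h) - \<Lambda> \<theta> < h * x + \<epsilon> * \<bar>h\<bar>" by linarith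
    moreover have hy: "h * (x + sgn h * \<epsilon>) = h * x + \<epsilon> * \<bar>h\<bar>"
      by (simp add: algebra_simps abs_sgn)
    ultimately have neg: "\<Lambda> (\<theta> + h) - h * (x + sgn h * \<epsilon>) - \<Lambda> \<theta> < 0" by simp
    then obtain c where c: "c > 0" "\<Lambda> (\<theta> + h) - h * (x + sgn h * \<epsilon>) - \<Lambda> \<theta> < - c"
      using dense[of "\<Lambda> (\<theta> + h) - h * (x + sgn h * \<epsilon>) - \<Lambda> \<theta>" 0] by (metis minus_less_iff neg_0_less_iff_less minus_minus)
    have "(\<lambda>n. L n (\<theta> + h) - h * (x + sgn h * \<epsilon>) - L n \<theta>) \<longlonglongrightarrow> \<Lambda> (\<theta> + h) - h * (x + sgn h * \<epsilon>) - \<Lambda> \<theta>"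
      by (intro tendsto_intros L_tendsto h' \<theta>)
    then have "eventually (\<lambda>n. L n (\<theta> + h) - h * (x + sgn h * \<epsilon>) - L n \<theta> < - c) sequentially"
      using c by (intro order_tendstoD)
    then show ?thesis
      using mgf[OF h'(2)] speed_gt[of "max 0 (ln 4 / c)"]
    proof eventually_elim
      case (elim n)
      have "a n > 0" "a n > ln 4 / c" using elim(3) by auto
      then have an: "a n > 0" "a n * c \<ge> ln 4" using c by (auto simp: pos_divide_less_eq)
      have "a n * (L n (\<theta> + h) - h * (x + sgn h * \<epsilon>)) \<le> a n * (L n \<theta> - c)"
        using elim(1) an by (intro mult_left_mono) auto
      also have "\<dots> \<le> a n * L n \<theta> - ln 4"
        using an by (simp add: algebra_simps)
      finally have "exp (a n * (L n (\<theta> + h) - h * (x + sgn h * \<epsilon>))) \<le> exp (a n * L n \<theta>) / 4"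
        by (subst (asm) exp_le_cancel_iff[symmetric]) (simp add: exp_diff)
      then show ?case
        using nn_integral_tilted_halfline[OF elim(2) an(1)] by (meson ennreal_leI order_trans)
    qed
  qed
  have "\<bar>t\<bar> = t" "\<bar>- t\<bar> = t" using t by auto
  note tails = this[THEN tail]
  have "(\<lambda>n. L n \<theta> - (\<theta> * x + \<bar>\<theta>\<bar> * \<epsilon>)) \<longlonglongrightarrow> \<Lambda> \<theta> - (\<theta> * x + \<bar>\<theta>\<bar> * \<epsilon>)"
    by (intro tendsto_intros L_tendsto \<theta>)
  \<comment> \<open>The gap r' + r pays for the factor 1/2 that the two tails cost.\<close>
  moreover obtain r' where r': "- r < r'" "r' < \<Lambda> \<theta> - (\<theta> * x + \<bar>\<theta>\<bar> * \<epsilon>)"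
    using dense[of "- r" "\<Lambda> \<theta> - (\<theta> * x + \<bar>\<theta>\<bar> * \<epsilon>)"] \<epsilon>r by auto
  ultimately have "eventually (\<lambda>n. L n \<theta> - (\<theta> * x + \<bar>\<theta>\<bar> * \<epsilon>) > r') sequentially"
    by (intro order_tendstoD)
  then show ?thesis
    using tails mgf[OF \<theta>] speed_gt[of "max 0 (ln 2 / (r' + r))"]
  proof eventually_elim
    case (elim n)
    interpret prob_space "M n" by (rule prob_space_M)
    have "a n > 0" "a n > ln 2 / (r' + r)" using elim(5) by auto
    then have an: "a n > 0" "a n * (r' + r) \<ge> ln 2" using r' by (auto simp: pos_divide_less_eq)
    define E where "E \<omega> = ennreal (exp (a n * \<theta> * X n \<omega>))" for \<omega>
    have [measurable]: "E \<in> borel_measurable (M n)" unfolding E_def by measurable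
    define A where "A h = {\<omega> \<in> space (M n). h * (x + sgn h * \<epsilon>) \<le> h * X n \<omega>}" for h
    have [measurable]: "A h \<in> sets (M n)" for h unfolding A_def by measurable
    define B where "B = {\<omega> \<in> space (M n). \<bar>X n \<omega> - x\<bar> < \<epsilon>}"
    have [measurable]: "B \<in> sets (M n)" unfolding B_def by measurable
    define p where "p = exp (a n * (\<theta> * x + \<bar>\<theta>\<bar> * \<epsilon>))"
    have "p > 0" by (simp add: p_def)
    have "ennreal (exp (a n * L n \<theta>)) = (\<integral>\<^sup>+\<omega>. E \<omega> \<partial>M n)"
      using elim(4) by (simp add: E_def)
    \<comment> \<open>The weight is at most p on the ball B, and the complement of B is covered by
      the two tails. As these take at most half of the mass, p times the probability of B is at
      least the other half.\<close>
    also have "\<dots> \<le> (\<integral>\<^sup>+\<omega>. ennreal p * indicator B \<omega> + (E \<omega> * indicator (A t) \<omega> + E \<omega> * indicator (A (- t)) \<omega>) \<partial>M n)"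
    proof (rule nn_integral_mono)
      fix \<omega> assume \<omega>: "\<omega> \<in> space (M n)"
      show "E \<omega> \<le> ennreal p * indicator B \<omega> + (E \<omega> * indicator (A t) \<omega> + E \<omega> * indicator (A (- t)) \<omega>)"
      proof (cases "\<omega> \<in> A t \<or> \<omega> \<in> A (- t)")
        case True
        then have "E \<omega> \<le> E \<omega> * indicator (A t) \<omega> + E \<omega> * indicator (A (- t)) \<omega>"
          by (auto simp: indicator_def)
        then show ?thesis by (rule order_trans) simp
      next
        case False
        then have *: "\<bar>X n \<omega> - x\<bar> < \<epsilon>" using \<omega> t by (auto simp: A_def not_le)
        then have B: "\<omega> \<in> B" using \<omega> by (simp add: B_def)
        have "\<theta> * (X n \<omega> - x) \<le> \<bar>\<theta>\<bar> * \<bar>X n \<omega> - x\<bar>"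
          unfolding abs_mult[symmetric] by (rule abs_ge_self)
        also have "\<dots> \<le> \<bar>\<theta>\<bar> * \<epsilon>"
          using * by (intro mult_left_mono) auto
        finally have "\<theta> * X n \<omega> \<le> \<theta> * x + \<bar>\<theta>\<bar> * \<epsilon>"
          by (simp add: right_diff_distrib)
        then have "a n * (\<theta> * X n \<omega>) \<le> a n * (\<theta> * x + \<bar>\<theta>\<bar> * \<epsilon>)"
          using an by (intro mult_left_mono) auto
        then have "E \<omega> \<le> ennreal p"
          unfolding E_def p_def by (intro ennreal_leI) (simp add: mult.assoc)
        also have "\<dots> = ennreal p * indicator B \<omega>" using B by simp
        finally show ?thesis by (rule order_trans) simp
      qed
    qed
    also have "\<dots> = ennreal p * emeasure (M n) B +
        ((\<integral>\<^sup>+\<omega>. E \<omega> * indicator (A t) \<omega> \<partial>M n) + (\<integral>\<^sup>+\<omega>. E \<omega> * indicator (A (- t)) \<omega> \<partial>M n))"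
      by (simp add: nn_integral_add nn_integral_cmult_indicator)
    also have "\<dots> \<le> ennreal p * emeasure (M n) B + (ennreal (exp (a n * L n \<theta>) / 4) + ennreal (exp (a n * L n \<theta>) / 4))"
      using elim(2,3) t unfolding E_def A_def by (intro add_mono order_refl) auto
    also have "\<dots> = ennreal (p * measure (M n) B + exp (a n * L n \<theta>) / 2)"
      unfolding emeasure_eq_measure
      by (simp add: ennreal_mult'[symmetric] ennreal_plus[symmetric] p_def del: ennreal_plus)
    finally have "exp (a n * L n \<theta>) \<le> p * measure (M n) B + exp (a n * L n \<theta>) / 2"
      by (subst (asm) ennreal_le_iff) (auto simp: p_def)
    then have "exp (a n * L n \<theta>) / 2 \<le> p * measure (M n) B" by simp
    then have "exp (a n * L n \<theta>) / 2 / p \<le> measure (M n) B"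
      using \<open>p > 0\<close> by (simp add: pos_divide_le_eq mult_ac)
    also have "exp (a n * L n \<theta>) / 2 / p = exp (a n * (L n \<theta> - (\<theta> * x + \<bar>\<theta>\<bar> * \<epsilon>)) - ln 2)"
      by (simp add: p_def exp_diff right_diff_distrib)
    also have "measure (M n) B \<le> measure (M n) {\<omega> \<in> space (M n). \<bar>X n \<omega> - x\<bar> < \<delta>}"
      using \<epsilon> by (intro finite_measure_mono) (auto simp: B_def)
    finally have "exp (a n * (L n \<theta> - (\<theta> * x + \<bar>\<theta>\<bar> * \<epsilon>)) - ln 2) \<le> measure (M n) {\<omega> \<in> space (M n). \<bar>X n \<omega> - x\<bar> < \<delta>}" .
    moreover have "- a n * r \<le> a n * (L n \<theta> - (\<theta> * x + \<bar>\<theta>\<bar> * \<epsilon>)) - ln 2"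
    proof -
      have "a n * r' \<le> a n * (L n \<theta> - (\<theta> * x + \<bar>\<theta>\<bar> * \<epsilon>))"
        using elim(1) an by (intro mult_left_mono) auto
      then show ?thesis using an by (simp add: algebra_simps)
    qed
    ultimately show ?case by (meson exp_le_cancel_iff order_trans)
  qed
qed

end

section \<open>From exponential bounds to limsup and liminf of logarithms\<close>

lemma limsup_ln_prob_le:
  assumes a: "filterlim a at_top sequentially" and p: "\<And>n. 0 \<le> p n"
    and bound: "\<And>r. ereal r < I \<Longrightarrow> eventually (\<lambda>n. p n \<le> exp (- a n * r)) sequentially"
  shows "limsup (\<lambda>n. ereal (1 / a n) * ln_prob (p n)) \<le> - I"
  unfolding Limsup_le_iff
proof (intro allI impI)
  fix y :: ereal assume "y > - I"
  then have "- y < I" by (simp add: ereal_uminus_less_reorder)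
  then obtain r where r: "- y < ereal r" "ereal r < I"
    using ereal_dense2 by blast
  have "eventually (\<lambda>n. a n > 0) sequentially"
    using a by (auto simp: filterlim_at_top_dense)
  with bound[OF r(2)] show "eventually (\<lambda>n. y > ereal (1 / a n) * ln_prob (p n)) sequentially"
  proof eventually_elim
    case (elim n)
    have y: "ereal (- r) < y" using r by (simp add: ereal_uminus_less_reorder flip: uminus_ereal.simps)
    have "ereal (1 / a n) * ln_prob (p n) \<le> ereal (- r)"
    proof (cases "p n = 0")
      case False
      then have "ln (p n) \<le> - a n * r"
        using p[of n] elim ln_le_cancel_iff[of "p n" "exp (- a n * r)"] by simp
      then show ?thesis using elim False by (simp add: ln_prob_def field_simps)
    qed (use elim in \<open>simp add: ln_prob_def\<close>)
    then show ?case using y by (rule le_less_trans)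
  qed
qed

text \<open>A real r strictly between I and -y exists even when I is minus infinity. For I =
  \<infinity> there is no such y, and the claim is vacuous.\<close>

lemma liminf_ln_prob_ge:
  assumes a: "filterlim a at_top sequentially"
    and bound: "\<And>r. I < ereal r \<Longrightarrow> eventually (\<lambda>n. exp (- a n * r) \<le> p n) sequentially"
  shows "liminf (\<lambda>n. ereal (1 / a n) * ln_prob (p n)) \<ge> - I"
  unfolding le_Liminf_iff
proof (intro allI impI)
  fix y :: ereal assume "y < - I"
  then have "I < - y" by (simp add: ereal_less_uminus_reorder)
  then obtain r where r: "I < ereal r" "ereal r < - y"
    using ereal_dense2 by blast
  have "eventually (\<lambda>n. a n > 0) sequentially"
    using a by (auto simp: filterlim_at_top_dense)
  with bound[OF r(1)] show "eventually (\<lambda>n. y < ereal (1 / a n) * ln_prob (p n)) sequentially"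
  proof eventually_elim
    case (elim n)
    have y: "y < ereal (- r)" using r by (simp add: ereal_less_uminus_reorder flip: uminus_ereal.simps)
    have p: "p n > 0" using elim(1) exp_gt_zero[of "- a n * r"] by linarith
    have "- a n * r \<le> ln (p n)"
      using p elim ln_le_cancel_iff[of "exp (- a n * r)" "p n"] by simp
    then have "ereal (- r) \<le> ereal (1 / a n) * ln_prob (p n)"
      using elim p by (simp add: ln_prob_def field_simps)
    then show ?case using y by (rule less_le_trans[rotated])
  qed
qed

subsection \<open>Rows of independent beta variables\<close>

lemma Beta_real_pos: "a > 0 \<Longrightarrow> b > 0 \<Longrightarrow> Beta a b > (0::real)"
  by (simp add: Beta_def)

lemma beta_density_measurable [measurable]: "beta_density a b \<in> borel_measurable borel"
  unfolding beta_density_def by measurable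

text \<open>On (0,1) the exponential is x^t, which shifts the first Beta parameter by t.\<close>

lemma nn_integral_beta_density_exp:
  assumes "a > 0" "b > 0" "a + t > 0"
  shows "(\<integral>\<^sup>+x. ennreal (beta_density a b x) * ennreal (exp (t * ln x)) \<partial>lborel) = ennreal (Beta (a + t) b / Beta a b)"
proof -
  define f where "f x = x powr (a + t - 1) * (1 - x) powr (b - 1)" for x :: real
  have [measurable]: "f \<in> borel_measurable borel"
    unfolding f_def by measurable
  have B: "Beta a b > 0" using Beta_real_pos assms by auto
  have "(f has_integral Beta (a + t) b) {0<..<1}"
    unfolding f_def has_integral_Icc_iff_Ioo[symmetric] using assms by (intro has_integral_Beta_real)
  then have I: "(\<integral>\<^sup>+x. ennreal (f x) * indicator {0<..<1} x \<partial>lborel) = ennreal (Beta (a + t) b)"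
    by (rule nn_integral_has_integral_lebesgue'[rotated]) (simp add: f_def)
  have "(\<integral>\<^sup>+x. ennreal (beta_density a b x) * ennreal (exp (t * ln x)) \<partial>lborel)
      = (\<integral>\<^sup>+x. ennreal (1 / Beta a b) * (ennreal (f x) * indicator {0<..<1} x) \<partial>lborel)"
  proof (intro nn_integral_cong)
    fix x :: real
    have "beta_density a b x * exp (t * ln x) = 1 / Beta a b * f x" if "0 < x" "x < 1"
      using that by (simp add: beta_density_def f_def powr_def exp_add[symmetric] algebra_simps)
    then show "ennreal (beta_density a b x) * ennreal (exp (t * ln x)) = ennreal (1 / Beta a b) * (ennreal (f x) * indicator {0<..<1} x)"
      using B by (auto simp: indicator_def beta_density_def f_def ennreal_mult'[symmetric] ennreal_mult''[symmetric])
  qed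
  also have "\<dots> = ennreal (1 / Beta a b) * ennreal (Beta (a + t) b)"
    by (subst nn_integral_cmult) (auto simp: I)
  also have "\<dots> = ennreal (Beta (a + t) b / Beta a b)"
    using B by (simp add: ennreal_mult'[symmetric])
  finally show ?thesis .
qed

text \<open>With both parameters at least 1 the two powers are increasing in their bases, and the
  normalising constant is at most Beta(1,1) = 1.\<close>

lemma beta_density_ge:
  assumes "a \<ge> 1" "b \<ge> 1" "0 < p" "p < x" "x \<le> 1 / 2"
  shows "p powr (a - 1) * (1 / 2) powr (b - 1) \<le> beta_density a b x"
proof -
  have "Beta a b \<le> Beta 1 1"
    using assms by (intro Beta_real_mono) auto
  also have "Beta 1 1 = (1 :: real)"
    using Gamma_fact[of 1, where 'a = real] by (simp add: Beta_def)
  finally have B: "Beta a b \<le> 1" .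
  have "p powr (a - 1) * (1 / 2) powr (b - 1) \<le> x powr (a - 1) * (1 - x) powr (b - 1)"
    using assms by (intro mult_mono powr_mono2) auto
  also have "\<dots> \<le> x powr (a - 1) * (1 - x) powr (b - 1) / Beta a b"
    using B Beta_real_pos[of a b] assms by (simp add: le_divide_eq mult_left_le)
  also have "\<dots> = beta_density a b x"
    using assms by (simp add: beta_density_def)
  finally show ?thesis .
qed

locale beta_rows =
  fixes b :: real and M :: "nat \<Rightarrow> 'a measure" and \<rho> :: "nat \<Rightarrow> nat \<Rightarrow> 'a \<Rightarrow> real"
  assumes b_pos: "b > 0"
    and prob: "\<And>n. prob_space (M n)"
    and indep: "\<And>n. prob_space.indep_vars (M n) (\<lambda>_. borel) (\<rho> n) {2..n}"
    and distr: "\<And>n k. 2 \<le> k \<Longrightarrow> k \<le> n \<Longrightarrow> distributed (M n) lborel (\<rho> n k)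
      (\<lambda>x. ennreal (beta_density (b * real (n - k + 1)) (b * real (k - 1)) x))"
begin

definition log_sum :: "nat \<Rightarrow> nat \<Rightarrow> 'a \<Rightarrow> real" where
  "log_sum n m \<omega> = (\<Sum>k=2..m. ln (\<rho> n k \<omega>))"

lemma rho_measurable: "2 \<le> k \<Longrightarrow> k \<le> n \<Longrightarrow> \<rho> n k \<in> borel_measurable (M n)"
  using distributed_measurable[OF distr] by simp

lemma log_sum_measurable: "m \<le> n \<Longrightarrow> log_sum n m \<in> borel_measurable (M n)"
  unfolding log_sum_def using rho_measurable by (intro borel_measurable_sum borel_measurable_ln) auto

lemma nn_integral_exp_log_rho:
  assumes "2 \<le> k" "k \<le> n" "b * real (n - k + 1) + t > 0"
  shows "(\<integral>\<^sup>+\<omega>. ennreal (exp (t * ln (\<rho> n k \<omega>))) \<partial>M n) =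
    ennreal (Beta (b * real (n - k + 1) + t) (b * real (k - 1)) / Beta (b * real (n - k + 1)) (b * real (k - 1)))"
proof -
  have "(\<integral>\<^sup>+\<omega>. ennreal (exp (t * ln (\<rho> n k \<omega>))) \<partial>M n) =
      (\<integral>\<^sup>+x. ennreal (beta_density (b * real (n - k + 1)) (b * real (k - 1)) x) * ennreal (exp (t * ln x)) \<partial>lborel)"
    by (rule distributed_nn_integral[OF distr, symmetric]) (use assms in auto)
  also have "\<dots> = ennreal (Beta (b * real (n - k + 1) + t) (b * real (k - 1)) / Beta (b * real (n - k + 1)) (b * real (k - 1)))"
    using assms b_pos by (intro nn_integral_beta_density_exp) auto
  finally show ?thesis .
qed

text \<open>Independence factorises the nonnegative integral. The positivity condition concerns the
  last factor k = m, whose first Beta parameter is the smallest.\<close>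

lemma nn_integral_exp_log_sum:
  assumes "m \<le> n" "real (n - m + 1) + real n * s > 0"
  shows "(\<integral>\<^sup>+\<omega>. ennreal (exp (b * real n * s * log_sum n m \<omega>)) \<partial>M n) = ennreal (exp (log_mgf b n m s))"
proof -
  interpret prob_space "M n" by (rule prob)
  let ?t = "b * real n * s"
  let ?R = "\<lambda>k. Beta (b * real (n - k + 1) + ?t) (b * real (k - 1)) / Beta (b * real (n - k + 1)) (b * real (k - 1))"
  have pos: "b * real (n - k + 1) + ?t > 0" if "k \<in> {2..m}" for k
  proof -
    have "real (n - m + 1) \<le> real (n - k + 1)" using that by auto
    then have "b * (real (n - k + 1) + real n * s) > 0" using assms b_pos by (intro mult_pos_pos) auto
    then show ?thesis by (simp add: algebra_simps)
  qed
  have R: "?R k > 0" if "k \<in> {2..m}" for k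
    using that pos[OF that] b_pos by (intro divide_pos_pos Beta_real_pos mult_pos_pos) auto
  have "indep_vars (\<lambda>_. borel) (\<rho> n) {2..m}"
    using assms by (intro indep_vars_subset[OF indep]) auto
  then have ind: "indep_vars (\<lambda>_. borel) (\<lambda>k \<omega>. ennreal (exp (?t * ln (\<rho> n k \<omega>)))) {2..m}"
    by (rule indep_vars_compose2) measurable
  have "(\<integral>\<^sup>+\<omega>. ennreal (exp (?t * log_sum n m \<omega>)) \<partial>M n) =
      (\<integral>\<^sup>+\<omega>. (\<Prod>k=2..m. ennreal (exp (?t * ln (\<rho> n k \<omega>)))) \<partial>M n)"
    unfolding log_sum_def sum_distrib_left exp_sum[OF finite_atLeastAtMost]
    by (subst prod_ennreal) auto
  also have "\<dots> = (\<Prod>k=2..m. \<integral>\<^sup>+\<omega>. ennreal (exp (?t * ln (\<rho> n k \<omega>))) \<partial>M n)"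
    by (intro indep_vars_nn_integral ind) auto
  also have "\<dots> = (\<Prod>k=2..m. ennreal (?R k))"
    using assms pos by (intro prod.cong refl nn_integral_exp_log_rho) auto
  also have "\<dots> = ennreal (\<Prod>k=2..m. ?R k)"
    using R by (intro prod_ennreal) (meson less_imp_le)
  also have "(\<Prod>k=2..m. ?R k) = exp (log_mgf b n m s)"
    unfolding log_mgf_def exp_sum[OF finite_atLeastAtMost] using R by (intro prod.cong refl) simp
  finally show ?thesis .
qed

lemma scaled_cumulants_log_sum:
  assumes T: "0 < T" "T < 1" and m: "\<And>n. real (m n) \<le> real n * T"
    and lim: "(\<lambda>n. real (m n) / n) \<longlonglongrightarrow> T"
  shows "scaled_cumulants M (\<lambda>n \<omega>. log_sum n (m n) \<omega> / n) (\<lambda>n. b * (real n)\<^sup>2)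
    (\<lambda>n s. log_mgf b n (m n) s / (b * (real n)\<^sup>2)) (cumulant T) {-(1-T)<..}"
proof (rule scaled_cumulants.intro)
  have mn: "m n \<le> n" for n
    using m[of n] T mult_left_mono[of T 1 "real n"] by linarith
  show "prob_space (M n)" for n by (rule prob)
  show "(\<lambda>\<omega>. log_sum n (m n) \<omega> / n) \<in> borel_measurable (M n)" for n
    using log_sum_measurable[OF mn] by measurable
  show "filterlim (\<lambda>n. b * (real n)\<^sup>2) at_top sequentially"
    using b_pos by real_asymp
  show "(\<lambda>n. log_mgf b n (m n) s / (b * (real n)\<^sup>2)) \<longlonglongrightarrow> cumulant T s" if "s \<in> {-(1-T)<..}" for s
    using that by (intro log_mgf_tendsto b_pos T m lim) auto
  show "open {-(1-T)<..}" by simp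
  show "eventually (\<lambda>n. (\<integral>\<^sup>+\<omega>. ennreal (exp (b * (real n)\<^sup>2 * s * (log_sum n (m n) \<omega> / n))) \<partial>M n) =
      ennreal (exp (b * (real n)\<^sup>2 * (log_mgf b n (m n) s / (b * (real n)\<^sup>2))))) sequentially"
    if s: "s \<in> {-(1-T)<..}" for s
    using eventually_gt_at_top[of 0]
  proof eventually_elim
    case (elim n)
    have "real n * (1 - T + s) \<ge> 0" using s by (intro mult_nonneg_nonneg) auto
    then have "real (n - m n + 1) + real n * s > 0"
      using m[of n] mn[of n] by (simp add: of_nat_diff algebra_simps)
    from nn_integral_exp_log_sum[OF mn this] show ?case
      using elim b_pos by (simp add: power2_eq_square mult_ac)
  qed
qed

text \<open>Near 0 the density of this factor behaves like a power of x with exponent about b n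
  (1-T). A value of order exp (-n c) therefore has probability about exp (-b n^2 c (1-T)).\<close>

lemma prob_log_rho_ge:
  assumes T: "0 < T" "T < 1" and m: "\<And>n. real (m n) \<le> real n * T"
    and lim: "(\<lambda>n. real (m n) / n) \<longlonglongrightarrow> T"
    and c: "c > 0" and \<delta>: "\<delta> > 0" and r: "c * (1 - T) < r"
  shows "eventually (\<lambda>n. exp (- (b * (real n)\<^sup>2) * r) \<le>
    measure (M n) {\<omega> \<in> space (M n). \<bar>ln (\<rho> n (m n) \<omega>) / n + c\<bar> < \<delta>}) sequentially"
proof -
  \<comment> \<open>d < c makes the upper end exp (-n (c - d)) of the interval tend to 0, and d
    \<le> \<delta> keeps the interval inside the target neighbourhood.\<close>
  define d where "d = min \<delta> c / 2"
  have d: "0 < d" "d < c" "d \<le> \<delta>" using c \<delta> by (auto simp: d_def)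
  \<comment> \<open>This is the cost n c A + b n ln 2 divided by b n^2; the term with ln 2 comes
    from the power of 1/2 in the density bound, with B - 1 replaced by b n.\<close>
  have "(\<lambda>n. c * (1 - real (m n) / n + 1 / n) + ln 2 * (1 / n)) \<longlonglongrightarrow> c * (1 - T + 0) + ln 2 * 0"
    by (intro tendsto_intros lim lim_1_over_n)
  then have ev1: "eventually (\<lambda>n. c * (1 - real (m n) / n + 1 / n) + ln 2 * (1 / n) < r) sequentially"
    by (rule order_tendstoD) (use r in simp)
  have ev2: "eventually (\<lambda>n. real (m n) / n > T / 2) sequentially"
    using T by (intro order_tendstoD[OF lim]) auto
  have ev3: "eventually (\<lambda>n. b * (real n * (1 - T)) \<ge> 1) sequentially"
    using b_pos T by real_asymp
  have ev4: "eventually (\<lambda>n. b * (real n * (T / 2) - 1) \<ge> 1) sequentially"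
    using b_pos T by real_asymp
  have ev5: "eventually (\<lambda>n. real n * (c - d) \<ge> ln 2) sequentially"
  proof -
    have "c - d > 0" using d by simp
    then show ?thesis by real_asymp
  qed
  have ev6: "eventually (\<lambda>n. real n * d \<ge> ln 2) sequentially"
    using d(1) by real_asymp
  show ?thesis
    using ev1 ev2 ev3 ev4 ev5 ev6 eventually_gt_at_top[of 0]
  proof eventually_elim
    case (elim n)
    interpret prob_space "M n" by (rule prob)
    have mn: "m n \<le> n"
      using m[of n] T mult_left_mono[of T 1 "real n"] by linarith
    define A where "A = b * real (n - m n + 1)"
    define B where "B = b * real (m n - 1)"
    have "real n * (T / 2) \<le> m n" using elim by (simp add: field_simps)
    moreover have m1: "m n \<ge> 1" using elim(2) T by (cases "m n") auto
    ultimately have "b * (real n * (T / 2) - 1) \<le> B"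
      unfolding B_def using b_pos by (intro mult_left_mono) (auto simp: of_nat_diff)
    then have "B \<ge> 1" using elim by linarith
    then have m2: "2 \<le> m n" by (cases "m n - 1") (auto simp: B_def)
    have "b * (real n * (1 - T)) \<le> A"
      unfolding A_def using b_pos m[of n] mn by (intro mult_left_mono) (auto simp: of_nat_diff algebra_simps)
    then have "A \<ge> 1" using elim by linarith
    \<comment> \<open>The interval (p, q) has length at least p because q \<ge> 2 p, so its length
      supplies the factor that turns p^(A-1) into p^A.\<close>
    define p where "p = exp (- (real n * c))"
    define q where "q = exp (- (real n * (c - d)))"
    have "q = p * exp (real n * d)"
      by (simp add: p_def q_def exp_add[symmetric] algebra_simps)
    moreover have "exp (real n * d) \<ge> 2"
      using elim(6) ln_ge_iff[of 2 "real n * d"] by (metis exp_le_cancel_iff exp_ln zero_less_numeral)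
    ultimately have qp: "p \<le> q - p"
      using mult_left_mono[of 2 "exp (real n * d)" p] by (simp add: p_def)
    have "q \<le> exp (- ln 2)"
      using elim(5) by (simp add: q_def)
    then have q2: "q \<le> 1 / 2" by (simp add: exp_minus)
    have p0: "p > 0" by (simp add: p_def)
    define K where "K = p powr (A - 1) * (1 / 2) powr (B - 1)"
    have "K \<ge> 0" by (simp add: K_def)
    have "ennreal (K * (q - p)) = (\<integral>\<^sup>+x. ennreal K * indicator {p<..<q} x \<partial>lborel)"
      using qp p0 \<open>K \<ge> 0\<close> by (subst nn_integral_cmult_indicator) (auto simp: ennreal_mult)
    also have "\<dots> \<le> (\<integral>\<^sup>+x. ennreal (beta_density A B x) * indicator {p<..<q} x \<partial>lborel)"
      unfolding K_def using q2 p0 \<open>A \<ge> 1\<close> \<open>B \<ge> 1\<close>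
      by (intro nn_integral_mono) (auto simp: indicator_def intro!: ennreal_leI beta_density_ge)
    also have "\<dots> = emeasure (M n) (\<rho> n (m n) -` {p<..<q} \<inter> space (M n))"
      unfolding A_def B_def by (rule distributed_emeasure[OF distr[OF m2 mn], symmetric]) simp
    also have "\<dots> \<le> emeasure (M n) {\<omega> \<in> space (M n). \<bar>ln (\<rho> n (m n) \<omega>) / n + c\<bar> < \<delta>}"
    proof (rule emeasure_mono)
      note [measurable] = rho_measurable[OF m2 mn]
      show "{\<omega> \<in> space (M n). \<bar>ln (\<rho> n (m n) \<omega>) / n + c\<bar> < \<delta>} \<in> sets (M n)"
        by measurable
      show "\<rho> n (m n) -` {p<..<q} \<inter> space (M n) \<subseteq> {\<omega> \<in> space (M n). \<bar>ln (\<rho> n (m n) \<omega>) / n + c\<bar> < \<delta>}"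
      proof safe
        fix \<omega> assume "\<rho> n (m n) \<omega> \<in> {p<..<q}"
        then have x: "p < \<rho> n (m n) \<omega>" "\<rho> n (m n) \<omega> < q" by auto
        have "ln p < ln (\<rho> n (m n) \<omega>)" "ln (\<rho> n (m n) \<omega>) < ln q"
          using x p0 by (auto intro!: ln_less_cancel_iff[THEN iffD2])
        then have "- c < ln (\<rho> n (m n) \<omega>) / n" "ln (\<rho> n (m n) \<omega>) / n < - (c - d)"
          using elim(7) by (auto simp: p_def q_def field_simps)
        then show "\<bar>ln (\<rho> n (m n) \<omega>) / n + c\<bar> < \<delta>" using d by auto
      qed
    qed
    finally have "K * (q - p) \<le> measure (M n) {\<omega> \<in> space (M n). \<bar>ln (\<rho> n (m n) \<omega>) / n + c\<bar> < \<delta>}"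
      unfolding emeasure_eq_measure by (subst (asm) ennreal_le_iff) auto
    moreover have "K * p \<le> K * (q - p)"
      using qp \<open>K \<ge> 0\<close> by (rule mult_left_mono)
    moreover have "K * p = exp (- (real n * c * A) - ln 2 * (B - 1))"
      unfolding K_def p_def by (simp add: powr_def exp_add[symmetric] ln_div algebra_simps)
    moreover have "- (b * (real n)\<^sup>2) * r \<le> - (real n * c * A) - ln 2 * (B - 1)"
    proof -
      have nB: "B \<le> b * n" unfolding B_def using b_pos mn by (intro mult_left_mono) auto
      have "ln 2 * (B - 1) \<le> ln 2 * (b * n)"
        using nB by (intro mult_left_mono) auto
      moreover have "real n * c * A + ln 2 * (b * n) \<le> b * (real n)\<^sup>2 * r"
      proof -
        have "real n * c * A + ln 2 * (b * n) = b * (real n)\<^sup>2 * (c * (1 - real (m n) / n + 1 / n) + ln 2 * (1 / n))"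
          unfolding A_def using elim(7) mn by (simp add: field_simps power2_eq_square of_nat_diff)
        also have "\<dots> \<le> b * (real n)\<^sup>2 * r"
          using elim(1) b_pos by (intro mult_left_mono) auto
        finally show ?thesis .
      qed
      ultimately show ?thesis unfolding mult_minus_left by linarith
    qed
    ultimately show ?case by (smt (verit) exp_le_cancel_iff)
  qed
qed

text \<open>The last logarithm is independent of the sum of the others, and by the triangle
  inequality the radii add. This lets a single factor carry the excess displacement c.\<close>

lemma prob_log_sum_ge_mult:
  assumes m: "2 \<le> m" "m \<le> n"
  shows "measure (M n) {\<omega> \<in> space (M n). \<bar>log_sum n (m - 1) \<omega> / n - y\<bar> < \<delta>} *
      measure (M n) {\<omega> \<in> space (M n). \<bar>ln (\<rho> n m \<omega>) / n + c\<bar> < \<delta>}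
    \<le> measure (M n) {\<omega> \<in> space (M n). \<bar>log_sum n m \<omega> / n - (y - c)\<bar> < 2 * \<delta>}"
proof -
  interpret prob_space "M n" by (rule prob)
  have ins: "{2..m} = insert m {2..m-1}" using m by auto
  have [measurable]: "log_sum n m \<in> borel_measurable (M n)"
    by (rule log_sum_measurable) fact
  have "indep_vars (\<lambda>_. borel) (\<rho> n) {2..m}"
    using m by (intro indep_vars_subset[OF indep]) auto
  then have "indep_vars (\<lambda>_. borel) (\<lambda>k \<omega>. ln (\<rho> n k \<omega>)) {2..m}"
    by (rule indep_vars_compose2) measurable
  then have ind: "indep_var borel (\<lambda>\<omega>. ln (\<rho> n m \<omega>)) borel (log_sum n (m - 1))"
    unfolding ins log_sum_def[abs_def] using m by (intro indep_vars_sum) auto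
  have sum: "log_sum n m \<omega> = ln (\<rho> n m \<omega>) + log_sum n (m - 1) \<omega>" for \<omega>
    unfolding log_sum_def ins using m by (subst sum.insert) auto
  have "measure (M n) {\<omega> \<in> space (M n). \<bar>ln (\<rho> n m \<omega>) / n + c\<bar> < \<delta>} *
      measure (M n) {\<omega> \<in> space (M n). \<bar>log_sum n (m - 1) \<omega> / n - y\<bar> < \<delta>} =
      measure (M n) {\<omega> \<in> space (M n). \<bar>ln (\<rho> n m \<omega>) / n + c\<bar> < \<delta> \<and> \<bar>log_sum n (m - 1) \<omega> / n - y\<bar> < \<delta>}"
    using prob_indep_random_variable[OF ind, of "{x. \<bar>x / n + c\<bar> < \<delta>}" "{x. \<bar>x / n - y\<bar> < \<delta>}"]
    by simp
  also have "\<dots> \<le> measure (M n) {\<omega> \<in> space (M n). \<bar>log_sum n m \<omega> / n - (y - c)\<bar> < 2 * \<delta>}"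
  proof (rule finite_measure_mono)
    show "{\<omega> \<in> space (M n). \<bar>log_sum n m \<omega> / n - (y - c)\<bar> < 2 * \<delta>} \<in> sets (M n)"
      by measurable
  qed (auto simp: sum add_divide_distrib)
  finally show ?thesis by (simp add: mult.commute)
qed

end

lemma floor_ratio_tendsto:
  assumes "T > 0"
  shows "(\<lambda>n. real (nat \<lfloor>real n * T\<rfloor>) / n) \<longlonglongrightarrow> T"
    and "(\<lambda>n. real (nat \<lfloor>real n * T\<rfloor> - 1) / n) \<longlonglongrightarrow> T"
proof -
  have *: "(\<lambda>n. real (nat \<lfloor>real n * T\<rfloor> - j) / n) \<longlonglongrightarrow> T" if "j \<le> 1" for j
  proof (rule tendsto_sandwich)
    show "(\<lambda>n. T - 2 / real n) \<longlonglongrightarrow> T" by real_asymp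
    show "eventually (\<lambda>n. T - 2 / real n \<le> real (nat \<lfloor>real n * T\<rfloor> - j) / n) sequentially"
      using eventually_gt_at_top[of 0]
    proof eventually_elim
      case (elim n)
      have "real n * T - 2 \<le> real (nat \<lfloor>real n * T\<rfloor> - j)"
        using that by linarith
      then have "(real n * T - 2) / n \<le> real (nat \<lfloor>real n * T\<rfloor> - j) / n"
        by (rule divide_right_mono) simp
      then show ?case using elim by (simp add: diff_divide_distrib)
    qed
    show "eventually (\<lambda>n. real (nat \<lfloor>real n * T\<rfloor> - j) / n \<le> T) sequentially"
      using eventually_gt_at_top[of 0]
    proof eventually_elim
      case (elim n)
      have "0 \<le> real n * T" using assms by simp
      then have "real (nat \<lfloor>real n * T\<rfloor> - j) \<le> real n * T" by linarith
      then show ?case using elim by (simp add: field_simps)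
    qed
  qed auto
  show "(\<lambda>n. real (nat \<lfloor>real n * T\<rfloor>) / n) \<longlonglongrightarrow> T"
    using *[of 0] by simp
  show "(\<lambda>n. real (nat \<lfloor>real n * T\<rfloor> - 1) / n) \<longlonglongrightarrow> T"
    using *[of 1] by simp
qed

section \<open>Large deviation upper and lower bounds for the logarithmic sums\<close>

context beta_rows
begin

text \<open>The mean \<Lambda>'(0) splits C into two closed parts. Each nonempty part lies in a
  half-line starting at its point nearest to the mean, which belongs to C, so Chernoff's inequality
  applies with s of the right sign. The factor 2 is absorbed by the gap between r and r'.\<close>

lemma ldp_upper_bound:
  assumes T: "0 < T" "T < 1" and C: "closed C"
  defines "X \<equiv> \<lambda>n \<omega>. log_sum n (nat \<lfloor>real n * T\<rfloor>) \<omega> / real n"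
  assumes r: "ereal r < (INF \<xi>\<in>C. IG T \<xi>)"
  shows "eventually (\<lambda>n. measure (M n) {\<omega> \<in> space (M n). X n \<omega> \<in> C} \<le> exp (- (b * (real n)\<^sup>2) * r)) sequentially"
proof -
  have mT: "real (nat \<lfloor>real n * T\<rfloor>) \<le> real n * T" for n using T by simp
  interpret scaled_cumulants M X "\<lambda>n. b * (real n)\<^sup>2"
    "\<lambda>n s. log_mgf b n (nat \<lfloor>real n * T\<rfloor>) s / (b * (real n)\<^sup>2)" "cumulant T" "{-(1-T)<..}"
    unfolding X_def by (rule scaled_cumulants_log_sum[OF T mT floor_ratio_tendsto(1)[OF T(1)]])
  obtain r' where r': "r < r'" "ereal r' < (INF \<xi>\<in>C. IG T \<xi>)"
    using ereal_dense2[OF r] by auto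
  let ?x = "dcumulant T 0"
  have upper: "eventually (\<lambda>n. measure (M n) {\<omega> \<in> space (M n). X n \<omega> \<in> C \<inter> {?x..}} \<le> exp (- (b * (real n)\<^sup>2) * r')) sequentially"
  proof (cases "C \<inter> {?x..} = {}")
    case True
    then show ?thesis by simp
  next
    case False
    define c where "c = Inf (C \<inter> {?x..})"
    have bdd: "bdd_below (C \<inter> {?x..})" by (auto intro: bdd_belowI[of _ ?x])
    have "c \<in> C \<inter> {?x..}"
      unfolding c_def using False C bdd by (intro closed_contains_Inf) auto
    then have "ereal r' < IG T c" "c \<ge> ?x"
      using r'(2) by (auto intro: less_le_trans INF_lower)
    then obtain s where s: "s \<ge> 0" "r' < s * c - cumulant T s"
      by (rule less_IG_D_right[OF T])
    have "eventually (\<lambda>n. measure (M n) {\<omega> \<in> space (M n). s * c \<le> s * X n \<omega>} \<le> exp (- (b * (real n)\<^sup>2) * r')) sequentially"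
      using s T by (intro chernoff_upper_bound) auto
    then show ?thesis
    proof eventually_elim
      case (elim n)
      interpret prob_space "M n" by (rule prob)
      have "measure (M n) {\<omega> \<in> space (M n). X n \<omega> \<in> C \<inter> {?x..}} \<le> measure (M n) {\<omega> \<in> space (M n). s * c \<le> s * X n \<omega>}"
        using s bdd by (intro finite_measure_mono) (auto simp: c_def intro!: mult_left_mono cInf_lower)
      then show ?case using elim by linarith
    qed
  qed
  have lower: "eventually (\<lambda>n. measure (M n) {\<omega> \<in> space (M n). X n \<omega> \<in> C \<inter> {..?x}} \<le> exp (- (b * (real n)\<^sup>2) * r')) sequentially"
  proof (cases "C \<inter> {..?x} = {}")
    case True
    then show ?thesis by simp
  next
    case False
    define c where "c = Sup (C \<inter> {..?x})"
    have bdd: "bdd_above (C \<inter> {..?x})" by (auto intro: bdd_aboveI[of _ ?x])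
    have "c \<in> C \<inter> {..?x}"
      unfolding c_def using False C bdd by (intro closed_contains_Sup) auto
    then have "ereal r' < IG T c" "c \<le> ?x"
      using r'(2) by (auto intro: less_le_trans INF_lower)
    then obtain s where s: "s > -(1-T)" "s \<le> 0" "r' < s * c - cumulant T s"
      by (rule less_IG_D_left[OF T])
    have "eventually (\<lambda>n. measure (M n) {\<omega> \<in> space (M n). s * c \<le> s * X n \<omega>} \<le> exp (- (b * (real n)\<^sup>2) * r')) sequentially"
      using s by (intro chernoff_upper_bound) auto
    then show ?thesis
    proof eventually_elim
      case (elim n)
      interpret prob_space "M n" by (rule prob)
      have "measure (M n) {\<omega> \<in> space (M n). X n \<omega> \<in> C \<inter> {..?x}} \<le> measure (M n) {\<omega> \<in> space (M n). s * c \<le> s * X n \<omega>}"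
        using s bdd by (intro finite_measure_mono) (auto simp: c_def intro!: mult_left_mono_neg cSup_upper)
      then show ?case using elim by linarith
    qed
  qed
  show ?thesis
    using upper lower speed_gt[of "ln 2 / (r' - r)"]
  proof eventually_elim
    case (elim n)
    interpret prob_space "M n" by (rule prob)
    have [measurable]: "C \<in> sets borel" using C by simp
    have "{\<omega> \<in> space (M n). X n \<omega> \<in> C} = {\<omega> \<in> space (M n). X n \<omega> \<in> C \<inter> {..?x}} \<union> {\<omega> \<in> space (M n). X n \<omega> \<in> C \<inter> {?x..}}"
      by auto
    also have "measure (M n) \<dots> \<le> measure (M n) {\<omega> \<in> space (M n). X n \<omega> \<in> C \<inter> {..?x}} + measure (M n) {\<omega> \<in> space (M n). X n \<omega> \<in> C \<inter> {?x..}}"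
      by (intro measure_Un_le) measurable
    also have "\<dots> \<le> 2 * exp (- (b * (real n)\<^sup>2) * r')"
      using elim by linarith
    also have "\<dots> = exp (ln 2 - b * (real n)\<^sup>2 * r')"
      by (simp add: exp_diff exp_minus field_simps)
    also have "\<dots> \<le> exp (- (b * (real n)\<^sup>2) * r)"
    proof -
      have "ln 2 < b * (real n)\<^sup>2 * (r' - r)"
        using elim(3) r' by (simp add: pos_divide_less_eq)
      then show ?thesis by (simp add: right_diff_distrib)
    qed
    finally show ?case .
  qed
qed

text \<open>It suffices to bound the probability of a small ball around one point x of U whose rate
  is below r. If x > -T, then x is a slope \<Lambda>'(\<theta>) at an interior \<theta> and tilting
  applies directly; otherwise the last factor makes the difference.\<close>

lemma ldp_lower_bound:
  assumes T: "0 < T" "T < 1" and U: "open U"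
  defines "X \<equiv> \<lambda>n \<omega>. log_sum n (nat \<lfloor>real n * T\<rfloor>) \<omega> / real n"
  assumes r: "(INF \<xi>\<in>U. IG T \<xi>) < ereal r"
  shows "eventually (\<lambda>n. exp (- (b * (real n)\<^sup>2) * r) \<le> measure (M n) {\<omega> \<in> space (M n). X n \<omega> \<in> U}) sequentially"
proof -
  have mT: "real (nat \<lfloor>real n * T\<rfloor>) \<le> real n * T" for n using T by simp
  have mT': "real (nat \<lfloor>real n * T\<rfloor> - 1) \<le> real n * T" for n using mT[of n] by linarith
  interpret scaled_cumulants M X "\<lambda>n. b * (real n)\<^sup>2"
    "\<lambda>n s. log_mgf b n (nat \<lfloor>real n * T\<rfloor>) s / (b * (real n)\<^sup>2)" "cumulant T" "{-(1-T)<..}"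
    unfolding X_def by (rule scaled_cumulants_log_sum[OF T mT floor_ratio_tendsto(1)[OF T(1)]])
  interpret less: scaled_cumulants M "\<lambda>n \<omega>. log_sum n (nat \<lfloor>real n * T\<rfloor> - 1) \<omega> / real n" "\<lambda>n. b * (real n)\<^sup>2"
    "\<lambda>n s. log_mgf b n (nat \<lfloor>real n * T\<rfloor> - 1) s / (b * (real n)\<^sup>2)" "cumulant T" "{-(1-T)<..}"
    by (rule scaled_cumulants_log_sum[OF T mT' floor_ratio_tendsto(2)[OF T(1)]])
  obtain x where x: "x \<in> U" "IG T x < ereal r"
    using r by (auto simp: INF_less_iff)
  then have "x < 0" by (auto simp: IG_def split: if_splits)
  obtain \<delta> where \<delta>: "\<delta> > 0" "\<And>y. \<bar>y - x\<bar> < \<delta> \<Longrightarrow> y \<in> U"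
    using U x(1) by (auto simp: open_dist dist_real_def)
  have "eventually (\<lambda>n. exp (- (b * (real n)\<^sup>2) * r) \<le> measure (M n) {\<omega> \<in> space (M n). \<bar>X n \<omega> - x\<bar> < \<delta>}) sequentially"
  proof (cases "x > -T")
    case True
    obtain \<theta> where \<theta>: "\<theta> \<ge> -(1-T)" "dcumulant T \<theta> = x"
      using dcumulant_surj[OF T, of x] True \<open>x < 0\<close> by auto
    have "\<theta> \<noteq> -(1-T)" using \<theta> True dcumulant_left_end[OF T] by auto
    then have "\<theta> > -(1-T)" using \<theta> by simp
    then show ?thesis
      using IG_dcumulant[OF T \<theta>(1)] x \<theta> \<delta> DERIV_cumulant[OF T \<open>\<theta> > -(1-T)\<close>]
      by (intro tilting_lower_bound[of \<theta>]) auto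
  next
    case False
    \<comment> \<open>J \<theta> is the total cost when the shortened sum aims at
      \<Lambda>'(\<theta>) and the last factor covers the distance to x. At the left end it equals
      the linear branch of \<open>IG\<close>, so by continuity some interior \<theta> still costs
      less than r.\<close>
    define J where "J \<theta> = \<theta> * dcumulant T \<theta> - cumulant T \<theta> + (dcumulant T \<theta> - x) * (1 - T)" for \<theta>
    have "continuous_on {-(1-T)..} J"
      unfolding J_def by (intro continuous_intros continuous_on_cumulant continuous_on_dcumulant T)
    then have "(J \<longlongrightarrow> J (-(1-T))) (at_right (-(1-T)))"
      unfolding at_within_Ici_at_right[symmetric] continuous_on_def by simp
    moreover have "J (-(1-T)) < r"
      using x(2) False dcumulant_left_end[OF T] IG_le_minus_T[OF T, of x]
      unfolding J_def by (simp add: algebra_simps)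
    ultimately have "eventually (\<lambda>\<theta>. J \<theta> < r) (at_right (-(1-T)))"
      by (rule order_tendstoD)
    moreover have "eventually (\<lambda>\<theta>. \<theta> > -(1-T)) (at_right (-(1-T)))"
      by (rule eventually_at_right_less)
    ultimately have "eventually (\<lambda>\<theta>. J \<theta> < r \<and> \<theta> > -(1-T)) (at_right (-(1-T)))"
      by eventually_elim auto
    then obtain \<theta> where \<theta>: "J \<theta> < r" "\<theta> > -(1-T)"
      using eventually_happens'[OF trivial_limit_at_right_real] by blast
    define y where "y = dcumulant T \<theta>"
    have c: "y - x > 0"
      using dcumulant_strict_mono[OF T, of "-(1-T)" \<theta>] \<theta> False dcumulant_left_end[OF T]
      by (simp add: y_def)
    \<comment> \<open>The slack is shared equally between the two independent events, whose
      exponents r1 and r2 then add up to r.\<close>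
    define e where "e = (r - J \<theta>) / 2"
    have e: "e > 0" using \<theta> by (simp add: e_def)
    define r1 where "r1 = \<theta> * y - cumulant T \<theta> + e"
    define r2 where "r2 = (y - x) * (1 - T) + e"
    have r12: "r = r1 + r2" by (simp add: r1_def r2_def e_def J_def y_def field_simps)
    have ev1: "eventually (\<lambda>n. exp (- (b * (real n)\<^sup>2) * r1) \<le>
        measure (M n) {\<omega> \<in> space (M n). \<bar>log_sum n (nat \<lfloor>real n * T\<rfloor> - 1) \<omega> / real n - y\<bar> < \<delta> / 2}) sequentially"
      using \<theta> \<delta> e DERIV_cumulant[OF T \<theta>(2)] unfolding y_def r1_def
      by (intro less.tilting_lower_bound[of \<theta>]) auto
    have ev2: "eventually (\<lambda>n. exp (- (b * (real n)\<^sup>2) * r2) \<le>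
        measure (M n) {\<omega> \<in> space (M n). \<bar>ln (\<rho> n (nat \<lfloor>real n * T\<rfloor>) \<omega>) / real n + (y - x)\<bar> < \<delta> / 2}) sequentially"
      using \<delta> e c by (intro prob_log_rho_ge[OF T mT floor_ratio_tendsto(1)[OF T(1)]]) (auto simp: r2_def)
    have ev3: "eventually (\<lambda>n. real n * T \<ge> 2) sequentially"
      using T by real_asymp
    show ?thesis using ev1 ev2 ev3
    proof eventually_elim
      case (elim n)
      have "real n * T \<le> real n * 1" using T by (intro mult_left_mono) auto
      then have m: "2 \<le> nat \<lfloor>real n * T\<rfloor>" "nat \<lfloor>real n * T\<rfloor> \<le> n"
        using elim(3) mT[of n] by linarith+
      have "exp (- (b * (real n)\<^sup>2) * r) = exp (- (b * (real n)\<^sup>2) * r1) * exp (- (b * (real n)\<^sup>2) * r2)"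
        unfolding r12 exp_add[symmetric] by (simp add: algebra_simps)
      also have "\<dots> \<le> measure (M n) {\<omega> \<in> space (M n). \<bar>log_sum n (nat \<lfloor>real n * T\<rfloor> - 1) \<omega> / real n - y\<bar> < \<delta> / 2} *
          measure (M n) {\<omega> \<in> space (M n). \<bar>ln (\<rho> n (nat \<lfloor>real n * T\<rfloor>) \<omega>) / real n + (y - x)\<bar> < \<delta> / 2}"
        using elim(1,2) by (intro mult_mono) auto
      also have "\<dots> \<le> measure (M n) {\<omega> \<in> space (M n). \<bar>X n \<omega> - (y - (y - x))\<bar> < 2 * (\<delta> / 2)}"
        unfolding X_def by (rule prob_log_sum_ge_mult[OF m])
      finally show ?case by simp
    qed
  qed
  then show ?thesis
  proof eventually_elim
    case (elim n)
    interpret prob_space "M n" by (rule prob)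
    have [measurable]: "U \<in> sets borel" using U by simp
    have "measure (M n) {\<omega> \<in> space (M n). \<bar>X n \<omega> - x\<bar> < \<delta>} \<le> measure (M n) {\<omega> \<in> space (M n). X n \<omega> \<in> U}"
      using \<delta> by (intro finite_measure_mono) auto
    with elim show ?case by linarith
  qed
qed

end

theorem theorem3p8:
  fixes \<beta> T :: real
    and M :: "nat \<Rightarrow> 'a measure"
    and \<rho> :: "nat \<Rightarrow> nat \<Rightarrow> 'a \<Rightarrow> real"
  assumes beta_pos: "\<beta> > 0"
    and T_range: "0 < T" "T < 1"
    and prob: "\<And>n. prob_space (M n)"
    and rho1: "\<And>n. \<rho> n 1 = (\<lambda>\<omega>. 1)"
    and indep: "\<And>n. prob_space.indep_vars (M n) (\<lambda>_. borel) (\<rho> n) {2..n}"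
    and distr: "\<And>n k. 2 \<le> k \<Longrightarrow> k \<le> n \<Longrightarrow>
        distributed (M n) lborel (\<rho> n k)
          (\<lambda>x. ennreal (beta_density ((\<beta> / 2) * real (n - k + 1)) ((\<beta> / 2) * real (k - 1)) x))"
  defines "X \<equiv> (\<lambda>n \<omega>. (\<Sum>k = 1..nat \<lfloor>real n * T\<rfloor>. ln (\<rho> n k \<omega>)) / real n)"
  shows
    "(\<forall>\<xi>. -T \<le> \<xi> \<and> \<xi> < 0 \<longrightarrow> (\<exists>!\<theta>. \<theta> \<ge> -(1 - T) \<and> theta_eq T \<xi> \<theta>))
     \<and> (\<forall>a. compact {\<xi>. IG T \<xi> \<le> ereal a})
     \<and> (\<forall>C. closed C \<longrightarrow>
          limsup (\<lambda>n. ereal (2 / (\<beta> * (real n)^2)) *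
              ln_prob (measure (M n) {\<omega> \<in> space (M n). X n \<omega> \<in> C}))
          \<le> - (INF \<xi>\<in>C. IG T \<xi>))
     \<and> (\<forall>U. open U \<longrightarrow>
          liminf (\<lambda>n. ereal (2 / (\<beta> * (real n)^2)) *
              ln_prob (measure (M n) {\<omega> \<in> space (M n). X n \<omega> \<in> U}))
          \<ge> - (INF \<xi>\<in>U. IG T \<xi>))"
proof -
  interpret beta_rows "\<beta> / 2" M \<rho>
    by (rule beta_rows.intro) (use beta_pos prob indep distr in auto)
  have X_eq: "X = (\<lambda>n \<omega>. log_sum n (nat \<lfloor>real n * T\<rfloor>) \<omega> / real n)"
  proof (intro ext)
    fix n \<omega>
    \<comment> \<open>The first factor is constantly 1 and contributes ln 1 = 0; for m = 0 both sums
      are empty.\<close>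
    have "(\<Sum>k = 1..m. ln (\<rho> n k \<omega>)) = log_sum n m \<omega>" for m
      by (cases "m \<ge> 1") (auto simp: log_sum_def rho1[unfolded One_nat_def] sum.atLeast_Suc_atMost numeral_2_eq_2)
    then show "X n \<omega> = log_sum n (nat \<lfloor>real n * T\<rfloor>) \<omega> / real n"
      by (simp add: X_def)
  qed
  have speed: "filterlim (\<lambda>n. \<beta> / 2 * (real n)\<^sup>2) at_top sequentially"
    using beta_pos by real_asymp
  have scale: "2 / (\<beta> * (real n)\<^sup>2) = 1 / (\<beta> / 2 * (real n)\<^sup>2)" for n
    by simp
  show ?thesis
    unfolding scale X_eq
  proof (intro conjI allI impI)
    show "\<exists>!\<theta>. \<theta> \<ge> -(1 - T) \<and> theta_eq T \<xi> \<theta>" if "-T \<le> \<xi> \<and> \<xi> < 0" for \<xi>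
      using ex1_theta[OF T_range] that by blast
    show "compact {\<xi>. IG T \<xi> \<le> ereal a}" for a
      by (rule compact_sublevel_IG[OF T_range])
  qed (intro limsup_ln_prob_le liminf_ln_prob_ge speed measure_nonneg
      ldp_upper_bound ldp_lower_bound T_range; assumption)+
qed

end
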